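(* Let $I_{r,n}$ be the number of inversions of the permutation obtained after $r$ iterated random-to-top shuffles of an $n$-card deck, starting from the identity. (i) Let $c>0$ be a constant. Then, as $n\to\infty$, $$\frac{I_{\lfloor cn\rfloor,n}-n^2(1-e^{-2c})/4}{n^{3/2}}$$ converges in distribution to $\mathcal{N}\left(0,\frac{1+8e^{-3c}-9(1+c)e^{-4c}}{36}\right)$. (ii) If $r=r(n)$ is a sequence of positive integers for which there exists a sequence $c_n\to\infty$ such that $r(n)\ge \frac{n\log n}{4}+c_n n$ for all sufficiently large $n$, then $$\frac{I_{r(n),n}-n^2/4}{n^{3/2}}$$ converges in distribution to $\mathcal{N}(0,1/36)$ as $n\to\infty$.
   Context: A deck of $n$ cards labelled $1,\dots,n$ in some order is encoded by the permutation $\pi$ of $[n]=\{1,\dots,n\}$ where $\pi(i)$ is the card in position $i$ (position $1$ is the top). A random-to-top shuffle selects one of the $n$ cards uniformly at random (the top card may be selected) and moves it to the top, keeping the relative order of the other cards. Iterated random-to-top shuffles start from the deck in order $12\cdots n$ and perform the selections independently. An inversion of $\pi$ is a pair $(i,j)$ with $1\le i<j\le n$ and $\pi(i)>\pi(j)$. $\mathcal{N}(\mu,\sigma^2)$ denotes the normal distribution with mean $\mu$ and variance $\sigma^2$. *)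

theory Defs
  imports "HOL-Probability.Probability"
begin

text \<open>
  A deck is the list of its cards from top to bottom, i.e. the one-line notation of the
  permutation \<open>\<pi>\<close>; positions are counted from 1.
\<close>

definition deck_perm :: "nat list \<Rightarrow> nat \<Rightarrow> nat" where
  "deck_perm d i = d ! (i - 1)"

definition inversions :: "nat \<Rightarrow> (nat \<Rightarrow> nat) \<Rightarrow> (nat \<times> nat) set" where
  "inversions n \<pi> = {(i, j). 1 \<le> i \<and> i < j \<and> j \<le> n \<and> \<pi> i > \<pi> j}"

definition move_to_top :: "nat \<Rightarrow> nat list \<Rightarrow> nat list" where
  "move_to_top c d = c # removeAll c d"

definition random_to_top :: "nat list \<Rightarrow> nat list pmf" where
  "random_to_top d = map_pmf (\<lambda>c. move_to_top c d) (pmf_of_set (set d))"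

text \<open>
  The law of the deck after \<open>r\<close> independent shuffles. It is meaningful for \<open>n \<ge> 1\<close> only,
  since \<^const>\<open>pmf_of_set\<close> is unspecified on the empty set.
\<close>

primrec iterated_random_to_top :: "nat \<Rightarrow> nat \<Rightarrow> nat list pmf" where
  "iterated_random_to_top n 0 = return_pmf [1..<Suc n]"
| "iterated_random_to_top n (Suc r) = bind_pmf (iterated_random_to_top n r) random_to_top"

text \<open>The law of \<open>I\<^sub>r\<^sub>,\<^sub>n\<close>.\<close>

definition inversions_pmf :: "nat \<Rightarrow> nat \<Rightarrow> nat pmf" where
  "inversions_pmf r n =
     map_pmf (\<lambda>d. card (inversions n (deck_perm d))) (iterated_random_to_top n r)"

text \<open>The parameter \<open>v\<close> is the variance, whereas \<^const>\<open>normal_density\<close> takes the standard deviation.\<close>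

definition normal_distribution :: "real \<Rightarrow> real \<Rightarrow> real measure" where
  "normal_distribution \<mu> v = density lborel (normal_density \<mu> (sqrt v))"

lemma iterated_random_to_top_permutation:
  assumes "n \<ge> 1" and "d \<in> set_pmf (iterated_random_to_top n r)"
  shows "length d = n \<and> set d = {1..n} \<and> distinct d"
  using assms(2)
proof (induction r arbitrary: d)
  case 0
  then show ?case by auto
next
  case (Suc r)
  then obtain e where e: "e \<in> set_pmf (iterated_random_to_top n r)"
    and d: "d \<in> set_pmf (random_to_top e)" by auto
  from Suc.IH[OF e] have "length e = n" "set e = {1..n}" "distinct e" by auto
  from \<open>set e = {1..n}\<close> assms(1) have "set_pmf (pmf_of_set (set e)) = {1..n}"
    by (subst set_pmf_of_set) auto
  with d obtain c where c: "c \<in> {1..n}" and d_eq: "d = c # removeAll c e"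
    unfolding random_to_top_def move_to_top_def set_map_pmf by blast
  have "set d = {1..n}"
    using c \<open>set e = {1..n}\<close> unfolding d_eq by (simp add: insert_absorb)
  moreover have "distinct d"
    using \<open>distinct e\<close> unfolding d_eq by (simp add: distinct_removeAll)
  ultimately have "length d = n" using distinct_card[of d] by simp
  with \<open>set d = {1..n}\<close> \<open>distinct d\<close> show ?case by simp
qed

end

theory Submission
  imports Defs "HOL-Real_Asymp.Real_Asymp"
begin

text \<open>
  Let \<open>m\<close> be the number of cards that were never selected. Given \<open>m\<close>, the deck consists of a uniformly
  random arrangement of \<open>n - m\<close> random cards on top of the other cards in increasing order, so the
  number of inversions is distributed as the sum of independent uniform variables on \<open>{0..l}\<close> for
  \<open>m \<le> l < n\<close>. Hence it has mean \<open>(n (n - 1) - m (m - 1)) / 4\<close> and variance about \<open>(n\<^sup>3 - m\<^sup>3) / 36\<close>.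
  The number \<open>m\<close> is a Markov chain that drops by one with probability \<open>m / n\<close>. As its drift is linear,
  its centred characteristic function satisfies \<open>\<phi> (r + 1) t \<approx> \<phi> r (\<rho> t) exp (- t\<^sup>2 \<rho>\<^sup>r (1 - \<rho>\<^sup>r) / 2)\<close>
  with \<open>\<rho> = 1 - 1 / n\<close>, which makes \<open>m\<close> asymptotically normal with mean \<open>n \<rho>\<^sup>r\<close>. Linearising \<open>m\<^sup>2\<close> around
  this mean gives an approximation of the characteristic function of the normalised inversion number
  with error \<open>O(1 / \<surd>n)\<close> uniformly in \<open>r\<close>, and Levy's continuity theorem yields both limits.
\<close>

section \<open>Decks with a random prefix\<close>

text \<open>\<open>expect_random_prefix k xs f\<close> is the expectation of \<open>f d\<close>, where the deck \<open>d\<close> consists of \<open>k\<close> cards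
  drawn one after another without replacement from \<open>xs\<close>, followed by the remaining cards in the order of \<open>xs\<close>.\<close>

primrec expect_random_prefix :: "nat \<Rightarrow> nat list \<Rightarrow> (nat list \<Rightarrow> complex) \<Rightarrow> complex" where
  "expect_random_prefix 0 xs f = f xs"
| "expect_random_prefix (Suc k) xs f =
     (\<Sum>x\<in>set xs. expect_random_prefix k (removeAll x xs) (\<lambda>ys. f (x # ys))) / of_nat (length xs)"

lemma length_removeAll_distinct:
  "distinct xs \<Longrightarrow> x \<in> set xs \<Longrightarrow> length (removeAll x xs) = length xs - 1"
  by (metis distinct_remove1_removeAll length_remove1)

lemma expect_random_prefix_cong:
  assumes "distinct xs"
    and "\<And>d. set d = set xs \<Longrightarrow> distinct d \<Longrightarrow> length d = length xs \<Longrightarrow> f d = g d"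
  shows "expect_random_prefix k xs f = expect_random_prefix k xs g"
  using assms
proof (induction k arbitrary: xs f g)
  case 0
  then show ?case by simp
next
  case (Suc k)
  have "expect_random_prefix k (removeAll x xs) (\<lambda>ys. f (x # ys)) =
        expect_random_prefix k (removeAll x xs) (\<lambda>ys. g (x # ys))" if x: "x \<in> set xs" for x
  proof (rule Suc.IH)
    show "distinct (removeAll x xs)" using Suc.prems by (simp add: distinct_removeAll)
    fix d assume d: "set d = set (removeAll x xs)" "distinct d" "length d = length (removeAll x xs)"
    show "f (x # d) = g (x # d)"
    proof (rule Suc.prems(2))
      show "set (x # d) = set xs" "distinct (x # d)" using d x by auto
      show "length (x # d) = length xs"
        using d x Suc.prems(1) length_removeAll_distinct[of xs x] by (cases xs) auto
    qed
  qed
  then show ?case by (simp cong: sum.cong)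
qed

lemma expect_random_prefix_add:
  "expect_random_prefix k xs (\<lambda>d. f d + g d) = expect_random_prefix k xs f + expect_random_prefix k xs g"
  by (induction k arbitrary: xs f g) (simp_all add: sum.distrib add_divide_distrib)

lemma expect_random_prefix_cmult:
  "expect_random_prefix k xs (\<lambda>d. a * f d) = a * expect_random_prefix k xs f"
  by (induction k arbitrary: xs f) (simp_all flip: sum_distrib_left)

lemma expect_random_prefix_zero: "expect_random_prefix k xs (\<lambda>d. 0) = 0"
  by (induction k arbitrary: xs) simp_all

lemma expect_random_prefix_sum:
  "finite A \<Longrightarrow> expect_random_prefix k xs (\<lambda>d. \<Sum>a\<in>A. f a d) = (\<Sum>a\<in>A. expect_random_prefix k xs (f a))"
  by (induction A rule: finite_induct) (simp_all add: expect_random_prefix_zero expect_random_prefix_add)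

text \<open>The card \<open>c\<close> lies in the random prefix with probability \<open>k / length xs\<close>.\<close>

lemma expect_random_prefix_removeAll:
  assumes "distinct xs" "c \<in> set xs" "k \<le> length xs"
  shows "of_nat (length xs) * expect_random_prefix k xs (\<lambda>d. f (removeAll c d)) =
    of_nat k * expect_random_prefix (k - 1) (removeAll c xs) f +
    of_nat (length xs - k) * expect_random_prefix k (removeAll c xs) f"
  using assms
proof (induction k arbitrary: xs f)
  case 0
  then show ?case by simp
next
  case (Suc k)
  define N where "N = length xs"
  have N: "N > 0" "Suc k \<le> N" using Suc.prems by (auto simp: N_def)
  have cardN: "card (set xs) = N" using Suc.prems distinct_card N_def by metis
  have len: "length (removeAll x xs) = N - 1" if "x \<in> set xs" for x
    using Suc.prems that by (simp add: N_def length_removeAll_distinct)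
  let ?T = "\<lambda>x. expect_random_prefix k (removeAll x xs) (\<lambda>ys. f (removeAll c (x # ys)))"
  let ?A = "expect_random_prefix k (removeAll c xs) f"
  \<comment> \<open>When \<open>c\<close> is the first card drawn, deleting it again leaves
    \<open>k\<close> random draws from the deck without \<open>c\<close>.\<close>
  have Tc: "?T c = ?A"
  proof -
    have "?T c = expect_random_prefix k (removeAll c xs) (\<lambda>ys. f ys)"
      by (rule expect_random_prefix_cong) (use Suc.prems in \<open>auto simp: distinct_removeAll\<close>)
    then show ?thesis by simp
  qed
  have L: "of_nat N * expect_random_prefix (Suc k) xs (\<lambda>d. f (removeAll c d)) =
     ?A + (\<Sum>x\<in>set xs - {c}. ?T x)"
    using N Suc.prems(2) Tc by (simp add: N_def sum.remove)
  \<comment> \<open>The one-card deck is separate because the general argument cancels the factor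
    \<open>N - 1\<close>.\<close>
  show ?case
  proof (cases "N = 1")
    case True
    then have "set xs = {c}" using cardN Suc.prems(2) by (metis card_1_singletonE singletonD)
    moreover have "k = 0" using True N by simp
    ultimately show ?thesis using L True by (simp add: N_def[symmetric])
  next
    case False
    then have N2: "N \<ge> 2" using N by linarith
    \<comment> \<open>A first draw \<open>x\<close> other than \<open>c\<close> leaves
      \<open>c\<close> among \<open>N - 1\<close> cards, so the induction hypothesis applies to the
      deck without \<open>x\<close>; the two deletions commute.\<close>
    have IH: "of_nat (N - 1) * ?T x =
       of_nat k * expect_random_prefix (k - 1) (removeAll x (removeAll c xs)) (\<lambda>ys. f (x # ys))
       + of_nat (N - Suc k) * expect_random_prefix k (removeAll x (removeAll c xs)) (\<lambda>ys. f (x # ys))"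
      if x: "x \<in> set xs - {c}" for x
    proof -
      have "distinct (removeAll x xs)" "c \<in> set (removeAll x xs)" "k \<le> length (removeAll x xs)"
        using Suc.prems x len[of x] N by (auto simp: distinct_removeAll)
      from Suc.IH[OF this, of "\<lambda>ys. f (x # ys)"] show ?thesis
        unfolding removeAll_commute[of x c] using x len[of x] by auto
    qed
    have lenc: "length (removeAll c xs) = N - 1" using Suc.prems len by simp
    \<comment> \<open>Summing over \<open>x\<close> reassembles the first draw from the deck without
      \<open>c\<close>, which has \<open>N - 1\<close> cards. In \<open>S2\<close> the factor
      \<open>k\<close> vanishes for \<open>k = 0\<close>, where the truncated \<open>k - 1\<close>
      is not one draw fewer.\<close>
    have S1: "(\<Sum>x\<in>set xs - {c}. expect_random_prefix k (removeAll x (removeAll c xs)) (\<lambda>ys. f (x # ys)))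
      = of_nat (N - 1) * expect_random_prefix (Suc k) (removeAll c xs) f"
      using N2 by (simp add: lenc)
    have S2: "of_nat k * (\<Sum>x\<in>set xs - {c}. expect_random_prefix (k - 1) (removeAll x (removeAll c xs)) (\<lambda>ys. f (x # ys)))
      = of_nat k * (of_nat (N - 1) * ?A)"
      using N2 by (cases k) (simp_all add: lenc)
    have "of_nat (N - 1) * (\<Sum>x\<in>set xs - {c}. ?T x) =
       of_nat k * (\<Sum>x\<in>set xs - {c}. expect_random_prefix (k - 1) (removeAll x (removeAll c xs)) (\<lambda>ys. f (x # ys)))
       + of_nat (N - Suc k) * (\<Sum>x\<in>set xs - {c}. expect_random_prefix k (removeAll x (removeAll c xs)) (\<lambda>ys. f (x # ys)))"
      unfolding sum_distrib_left sum.distrib[symmetric] by (intro sum.cong refl IH)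
    also have "\<dots> = of_nat (N - 1) * (of_nat k * ?A + of_nat (N - Suc k) * expect_random_prefix (Suc k) (removeAll c xs) f)"
      unfolding S1 S2 by (simp add: algebra_simps)
    finally have "(\<Sum>x\<in>set xs - {c}. ?T x) = of_nat k * ?A + of_nat (N - Suc k) * expect_random_prefix (Suc k) (removeAll c xs) f"
      using N2 by (simp del: of_nat_diff)
    with L show ?thesis by (simp add: N_def[symmetric] algebra_simps)
  qed
qed

text \<open>A uniformly chosen card moved to the top acts as a new first draw. If it came from the
  random prefix, the prefix again consists of \<open>k\<close> random draws; otherwise the prefix
  grows by one fresh card. \<open>expect_random_prefix_removeAll\<close> separates the two
  cases.\<close>

lemma expect_random_prefix_move_to_top:
  assumes "distinct xs" "k \<le> length xs" "xs \<noteq> []"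
  shows "expect_random_prefix k xs (\<lambda>d. (\<Sum>c\<in>set xs. f (move_to_top c d)) / of_nat (length xs)) =
    of_real (real k / real (length xs)) * expect_random_prefix k xs f +
    of_real (1 - real k / real (length xs)) * expect_random_prefix (Suc k) xs f"
proof -
  define N where "N = length xs"
  have N: "(of_nat N :: complex) \<noteq> 0" using assms by (simp add: N_def)
  have "expect_random_prefix k xs (\<lambda>d. (\<Sum>c\<in>set xs. f (move_to_top c d)) / of_nat N) =
    expect_random_prefix k xs (\<lambda>d. (1 / of_nat N) * (\<Sum>c\<in>set xs. f (move_to_top c d)))"
    by simp
  also have "\<dots> = (1 / of_nat N) * (\<Sum>c\<in>set xs. expect_random_prefix k xs (\<lambda>d. f (c # removeAll c d)))"
    unfolding move_to_top_def by (subst expect_random_prefix_cmult) (simp add: expect_random_prefix_sum)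
  also have "(\<Sum>c\<in>set xs. expect_random_prefix k xs (\<lambda>d. f (c # removeAll c d))) =
     (\<Sum>c\<in>set xs. (of_nat k * expect_random_prefix (k - 1) (removeAll c xs) (\<lambda>ys. f (c # ys)) +
       of_nat (N - k) * expect_random_prefix k (removeAll c xs) (\<lambda>ys. f (c # ys))) / of_nat N)"
    using expect_random_prefix_removeAll[OF assms(1) _ assms(2), where f = "\<lambda>ys. f (c # ys)" and c = c for c] N
    by (intro sum.cong refl) (simp add: N_def[symmetric] nonzero_eq_divide_eq ac_simps)
  also have "\<dots> = of_nat k * (\<Sum>c\<in>set xs. expect_random_prefix (k - 1) (removeAll c xs) (\<lambda>ys. f (c # ys))) / of_nat N
       + of_nat (N - k) * expect_random_prefix (Suc k) xs f"
    by (simp add: N_def sum.distrib sum_distrib_left add_divide_distrib sum_divide_distrib)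
  also have "of_nat k * (\<Sum>c\<in>set xs. expect_random_prefix (k - 1) (removeAll c xs) (\<lambda>ys. f (c # ys))) / of_nat N =
     of_nat k * expect_random_prefix k xs f"
    by (cases k) (simp_all add: N_def)
  finally show ?thesis
    using N assms(2) by (simp add: N_def[symmetric] field_simps of_nat_diff)
qed

section \<open>Inversions\<close>

text \<open>The sum of the Lehmer code, in a form that splits off the contribution of the top
  card.\<close>

fun inversion_count :: "nat list \<Rightarrow> nat" where
  "inversion_count [] = 0"
| "inversion_count (x # ys) = card {y \<in> set ys. y < x} + inversion_count ys"

lemma card_inversions_deck_perm:
  "distinct d \<Longrightarrow> card (inversions (length d) (deck_perm d)) = inversion_count d"
proof (induction d)
  case Nil
  have "inversions 0 (deck_perm []) = {}" by (auto simp: inversions_def)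
  then show ?case by simp
next
  case (Cons x ys)
  \<comment> \<open>\<open>B\<close> collects the inversions involving the top card; index
    \<open>j\<close> in \<open>ys\<close> is position \<open>j + 2\<close> of the deck, shifted once
    for the top card and once for counting from 1. \<open>C\<close> is the shifted copy of the
    inversions of the tail.\<close>
  define B where "B = (\<lambda>j. (1::nat, j + 2)) ` {j. j < length ys \<and> ys ! j < x}"
  define C where "C = (\<lambda>(i, j). (Suc i, Suc j)) ` inversions (length ys) (deck_perm ys)"
  have fin: "finite (inversions n \<pi>)" for n \<pi>
    by (rule finite_subset[of _ "{1..n} \<times> {1..n}"]) (auto simp: inversions_def)
  have eq: "inversions (length (x # ys)) (deck_perm (x # ys)) = B \<union> C"
  proof (intro set_eqI iffI)
    fix p assume p: "p \<in> inversions (length (x # ys)) (deck_perm (x # ys))"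
    obtain i j where ij: "p = (i, j)" "1 \<le> i" "i < j" "j \<le> Suc (length ys)"
      "(x # ys) ! (j - 1) < (x # ys) ! (i - 1)"
      using p by (auto simp: inversions_def deck_perm_def)
    show "p \<in> B \<union> C"
    proof (cases "i = 1")
      case True
      then show ?thesis using ij unfolding B_def
        by (intro UnI1 image_eqI[of _ _ "j - 2"]) (auto simp: nth_Cons' numeral_2_eq_2)
    next
      case False
      then show ?thesis using ij unfolding C_def
        by (intro UnI2 image_eqI[of _ _ "(i - 1, j - 1)"])
          (auto simp: inversions_def deck_perm_def nth_Cons')
    qed
  next
    fix p assume "p \<in> B \<union> C"
    then show "p \<in> inversions (length (x # ys)) (deck_perm (x # ys))"
      by (auto simp: B_def C_def inversions_def deck_perm_def nth_Cons')
  qed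
  have disj: "B \<inter> C = {}" by (auto simp: B_def C_def inversions_def)
  have "card B = card {j. j < length ys \<and> ys ! j < x}"
    unfolding B_def by (rule card_image) (auto simp: inj_on_def)
  also have "\<dots> = card ((!) ys ` {j. j < length ys \<and> ys ! j < x})"
    using Cons.prems by (intro card_image[symmetric]) (auto simp: inj_on_def nth_eq_iff_index_eq)
  also have "(!) ys ` {j. j < length ys \<and> ys ! j < x} = {y \<in> set ys. y < x}"
    by (auto simp: in_set_conv_nth)
  finally have B: "card B = card {y \<in> set ys. y < x}" .
  have "card C = inversion_count ys"
    unfolding C_def using Cons by (subst card_image) (auto simp: inj_on_def)
  then show ?case
    unfolding eq using B disj fin by (subst card_Un_disjoint) (auto simp: B_def C_def)
qed

text \<open>The characteristic function at \<open>s\<close> of the uniform distribution on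
  \<open>{0..l}\<close>.\<close>

definition uniform_char :: "nat \<Rightarrow> real \<Rightarrow> complex" where
  "uniform_char l s = (\<Sum>j\<le>l. iexp (s * real j)) / of_nat (Suc l)"

text \<open>In a strictly increasing list exactly \<open>j\<close> entries lie below the entry at
  index \<open>j\<close>, so the ranks run once through all indices. Hence a uniformly drawn card
  has uniform rank.\<close>

lemma sum_rank_sorted:
  fixes xs :: "nat list" and h :: "nat \<Rightarrow> 'a::comm_monoid_add"
  assumes "sorted xs" "distinct xs"
  shows "(\<Sum>x\<in>set xs. h (card {y \<in> set xs. y < x})) = (\<Sum>j<length xs. h j)"
proof -
  have ss: "sorted_wrt (<) xs" using assms by (simp add: strict_sorted_iff)
  have "card {y \<in> set xs. y < xs ! j} = j" if j: "j < length xs" for j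
  proof -
    have "{y \<in> set xs. y < xs ! j} = (!) xs ` {..<j}"
    proof (intro set_eqI iffI)
      fix y assume "y \<in> {y \<in> set xs. y < xs ! j}"
      then obtain i where i: "i < length xs" "y = xs ! i" "xs ! i < xs ! j"
        by (auto simp: in_set_conv_nth)
      then have "i < j" using sorted_wrt_nth_less[OF ss] j
        by (metis linorder_neqE_nat not_less_iff_gr_or_eq)
      then show "y \<in> (!) xs ` {..<j}" using i by auto
    next
      fix y assume "y \<in> (!) xs ` {..<j}"
      then show "y \<in> {y \<in> set xs. y < xs ! j}"
        using sorted_wrt_nth_less[OF ss] j by auto
    qed
    moreover have "inj_on ((!) xs) {..<j}"
      using assms j by (auto simp: inj_on_def nth_eq_iff_index_eq)
    ultimately show ?thesis by (simp add: card_image)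
  qed
  then have "(\<Sum>j<length xs. h j) = (\<Sum>j<length xs. h (card {y \<in> set xs. y < xs ! j}))"
    by simp
  also have "\<dots> = (\<Sum>x\<in>set xs. h (card {y \<in> set xs. y < x}))"
    by (rule sum.reindex_bij_betw[OF bij_betw_nth[OF assms(2) refl refl]])
  finally show ?thesis by simp
qed

lemma inversion_count_sorted: "sorted xs \<Longrightarrow> inversion_count xs = 0"
  by (induction xs) (auto simp: not_less)

text \<open>The first card drawn has uniform rank and is inverted with exactly the smaller cards,
  whatever their order beneath it. Deleting it leaves a sorted list, so the later draws contribute
  independent uniform ranks on ever smaller ranges; the undrawn cards stay sorted and contribute
  nothing.\<close>

lemma expect_random_prefix_inversion_count:
  assumes "sorted xs" "distinct xs" "k \<le> length xs"
  shows "expect_random_prefix k xs (\<lambda>d. iexp (s * real (inversion_count d))) =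
    (\<Prod>l\<in>{length xs - k..<length xs}. uniform_char l s)"
  using assms
proof (induction k arbitrary: xs)
  case 0
  then show ?case by (simp add: inversion_count_sorted)
next
  case (Suc k)
  define N where "N = length xs"
  have N: "Suc k \<le> N" using Suc.prems by (simp add: N_def)
  have step: "expect_random_prefix k (removeAll x xs) (\<lambda>ys. iexp (s * real (inversion_count (x # ys)))) =
     iexp (s * real (card {y \<in> set xs. y < x})) * (\<Prod>l\<in>{N - Suc k..<N - 1}. uniform_char l s)"
    if x: "x \<in> set xs" for x
  proof -
    have d: "distinct (removeAll x xs)" "sorted (removeAll x xs)"
      using Suc.prems by (auto simp: distinct_removeAll removeAll_filter_not_eq sorted_wrt_filter)
    have l: "length (removeAll x xs) = N - 1"
      using Suc.prems x by (simp add: N_def length_removeAll_distinct)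
    have "expect_random_prefix k (removeAll x xs) (\<lambda>ys. iexp (s * real (inversion_count (x # ys)))) =
      expect_random_prefix k (removeAll x xs)
        (\<lambda>ys. iexp (s * real (card {y \<in> set xs. y < x})) * iexp (s * real (inversion_count ys)))"
    proof (rule expect_random_prefix_cong[OF d(1)])
      fix ys assume "set ys = set (removeAll x xs)"
      then have "{y \<in> set ys. y < x} = {y \<in> set xs. y < x}" by auto
      then show "iexp (s * real (inversion_count (x # ys))) =
          iexp (s * real (card {y \<in> set xs. y < x})) * iexp (s * real (inversion_count ys))"
        by (simp add: algebra_simps flip: exp_add)
    qed
    also have "\<dots> = iexp (s * real (card {y \<in> set xs. y < x})) * (\<Prod>l\<in>{N - Suc k..<N - 1}. uniform_char l s)"
      using Suc.IH[OF d(2,1)] l N by (simp add: expect_random_prefix_cmult)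
    finally show ?thesis .
  qed
  have "expect_random_prefix (Suc k) xs (\<lambda>d. iexp (s * real (inversion_count d))) =
    (\<Sum>x\<in>set xs. iexp (s * real (card {y \<in> set xs. y < x}))) / of_nat N * (\<Prod>l\<in>{N - Suc k..<N - 1}. uniform_char l s)"
    using step by (simp add: N_def sum_distrib_right cong: sum.cong del: inversion_count.simps)
  also have "(\<Sum>x\<in>set xs. iexp (s * real (card {y \<in> set xs. y < x}))) / of_nat N = uniform_char (N - 1) s"
  proof -
    have "{..N - 1} = {..<N}" using N by auto
    then show ?thesis
      using sum_rank_sorted[OF Suc.prems(1,2), of "\<lambda>j. iexp (s * real j)"] N
      by (simp add: uniform_char_def N_def)
  qed
  also have "uniform_char (N - 1) s * (\<Prod>l\<in>{N - Suc k..<N - 1}. uniform_char l s) =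
     (\<Prod>l\<in>{N - Suc k..<Suc (N - 1)}. uniform_char l s)"
    using N by (subst prod.atLeastLessThan_Suc) (auto simp: ac_simps)
  also have "Suc (N - 1) = N" using N by simp
  finally show ?case unfolding N_def .
qed

section \<open>The number of untouched cards\<close>

text \<open>\<open>expect_untouched n r g\<close> is the expectation of \<open>g m\<close> where \<open>m\<close> is the number of cards
  that have never been selected in the first \<open>r\<close> shuffles.\<close>

primrec expect_untouched :: "nat \<Rightarrow> nat \<Rightarrow> (nat \<Rightarrow> 'a::real_normed_vector) \<Rightarrow> 'a" where
  "expect_untouched n 0 g = g n"
| "expect_untouched n (Suc r) g = expect_untouched n r
     (\<lambda>m. (real m / real n) *\<^sub>R g (m - 1) + (1 - real m / real n) *\<^sub>R g m)"

lemma expect_untouched_cong: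
  "(\<And>m. m \<le> n \<Longrightarrow> g m = h m) \<Longrightarrow> expect_untouched n r g = expect_untouched n r h"
proof (induction r arbitrary: g h)
  case (Suc r)
  show ?case
    unfolding expect_untouched.simps
    by (rule Suc.IH) (auto simp: Suc.prems)
qed simp

text \<open>Given \<open>m\<close> untouched cards the deck has a random prefix of length
  \<open>n - m\<close>, and the next shuffle lengthens it with probability \<open>m / n\<close>.
  This matches the recursion of \<open>expect_untouched\<close>, which applies the last transition
  to the observable first.\<close>

lemma expectation_iterated_random_to_top:
  assumes "n \<ge> 1"
  shows "measure_pmf.expectation (iterated_random_to_top n r) f =
    expect_untouched n r (\<lambda>m. expect_random_prefix (n - m) [1..<Suc n] f)"
proof (induction r arbitrary: f)
  case 0
  then show ?case by simp
next
  case (Suc r)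
  define xs where "xs = [1..<Suc n]"
  have xs: "distinct xs" "length xs = n" "xs \<noteq> []" "set xs = {1..n}" using assms by (auto simp: xs_def)
  define P where "P = iterated_random_to_top n r"
  define D where "D = set_pmf P"
  have D: "length d = n" "set d = {1..n}" "distinct d" if "d \<in> D" for d
    using iterated_random_to_top_permutation[OF assms, of d r] that by (auto simp: D_def P_def)
  have finD: "finite D"
    by (rule finite_subset[OF _ finite_lists_length_eq[of "{1..n}" n]]) (use D in auto)
  have rtt: "measure_pmf.expectation (random_to_top d) f = (\<Sum>c\<in>set xs. f (move_to_top c d)) / of_nat (length xs)"
    if "d \<in> D" for d
    using D[OF that] xs assms unfolding random_to_top_def
    by (subst integral_map_pmf, subst integral_measure_pmf[of "{1..n}"])
      (auto simp: sum_divide_distrib scaleR_conv_of_real field_simps)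
  have "measure_pmf.expectation (iterated_random_to_top n (Suc r)) f =
     (\<Sum>d\<in>D. pmf P d *\<^sub>R measure_pmf.expectation (random_to_top d) f)"
    unfolding iterated_random_to_top.simps P_def[symmetric]
  proof (rule pmf_expectation_bind[OF finD])
    fix d assume "d \<in> D"
    then show "finite (set_pmf (random_to_top d))"
      using D[of d] assms unfolding random_to_top_def by (subst set_map_pmf, subst set_pmf_of_set) auto
  qed (simp add: D_def)
  also have "\<dots> = measure_pmf.expectation P (\<lambda>d. (\<Sum>c\<in>set xs. f (move_to_top c d)) / of_nat (length xs))"
    using rtt by (subst integral_measure_pmf[OF finD]) (auto simp: D_def)
  also have "\<dots> = expect_untouched n r (\<lambda>m. expect_random_prefix (n - m) xs
       (\<lambda>d. (\<Sum>c\<in>set xs. f (move_to_top c d)) / of_nat (length xs)))"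
    unfolding P_def xs_def by (rule Suc.IH)
  also have "\<dots> = expect_untouched n r (\<lambda>m. (real m / real n) *\<^sub>R expect_random_prefix (n - (m - 1)) xs f
        + (1 - real m / real n) *\<^sub>R expect_random_prefix (n - m) xs f)"
  proof (rule expect_untouched_cong)
    fix m assume m: "m \<le> n"
    have 1: "real (n - m) / real n = 1 - real m / real n"
      using m assms by (simp add: of_nat_diff field_simps)
    \<comment> \<open>For \<open>m = 0\<close> the truncated \<open>m - 1\<close> gives another
      prefix length, but its weight is zero.\<close>
    have 2: "(real m / real n) *\<^sub>R expect_random_prefix (Suc (n - m)) xs f
       = (real m / real n) *\<^sub>R expect_random_prefix (n - (m - 1)) xs f"
    proof (cases "m = 0")
      case False
      then have "Suc (n - m) = n - (m - 1)" using m by simp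
      then show ?thesis by (simp only:)
    qed simp
    show "expect_random_prefix (n - m) xs (\<lambda>d. (\<Sum>c\<in>set xs. f (move_to_top c d)) / of_nat (length xs)) =
       (real m / real n) *\<^sub>R expect_random_prefix (n - (m - 1)) xs f
        + (1 - real m / real n) *\<^sub>R expect_random_prefix (n - m) xs f"
      unfolding 2[symmetric]
      using expect_random_prefix_move_to_top[OF xs(1) _ xs(3), of "n - m" f]
      unfolding xs(2) 1 by (simp add: scaleR_conv_of_real del: expect_random_prefix.simps)
  qed
  finally show ?case by (simp add: xs_def)
qed

text \<open>This removes the decks from the problem: what remains is the chain \<open>m\<close> and
  a product of explicit characteristic functions.\<close>

lemma expectation_inversions_pmf:
  assumes "n \<ge> 1"
  shows "measure_pmf.expectation (inversions_pmf r n) (\<lambda>I. iexp (s * real I)) =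
    expect_untouched n r (\<lambda>m. \<Prod>l\<in>{m..<n}. uniform_char l s)"
proof -
  have "measure_pmf.expectation (inversions_pmf r n) (\<lambda>I. iexp (s * real I)) =
    expect_untouched n r (\<lambda>m. expect_random_prefix (n - m) [1..<Suc n]
      (\<lambda>d. iexp (s * real (card (inversions n (deck_perm d))))))"
    using assms by (simp add: inversions_pmf_def expectation_iterated_random_to_top del: upt_Suc)
  also have "\<dots> = expect_untouched n r (\<lambda>m. \<Prod>l\<in>{m..<n}. uniform_char l s)"
  proof (rule expect_untouched_cong)
    fix m assume m: "m \<le> n"
    have "expect_random_prefix (n - m) [1..<Suc n] (\<lambda>d. iexp (s * real (card (inversions n (deck_perm d)))))
      = expect_random_prefix (n - m) [1..<Suc n] (\<lambda>d. iexp (s * real (inversion_count d)))"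
      by (rule expect_random_prefix_cong) (auto simp del: upt_Suc simp flip: card_inversions_deck_perm)
    also have "\<dots> = (\<Prod>l\<in>{m..<n}. uniform_char l s)"
      using m by (subst expect_random_prefix_inversion_count) (auto simp del: upt_Suc)
    finally show "expect_random_prefix (n - m) [1..<Suc n] (\<lambda>d. iexp (s * real (card (inversions n (deck_perm d)))))
      = (\<Prod>l\<in>{m..<n}. uniform_char l s)" .
  qed
  finally show ?thesis .
qed

section \<open>Expectation calculus and moments for the number of untouched cards\<close>

lemma expect_untouched_add:
  "expect_untouched n r (\<lambda>m. f m + g m) = expect_untouched n r f + expect_untouched n r g"
proof (induction r arbitrary: f g)
  case (Suc r)
  show ?case
    unfolding expect_untouched.simps Suc.IH[symmetric]
    by (rule expect_untouched_cong) (simp add: scaleR_add_right)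
qed simp

lemma expect_untouched_bounded_linear:
  assumes "bounded_linear T"
  shows "expect_untouched n r (\<lambda>m. T (f m)) = T (expect_untouched n r f)"
proof -
  interpret bounded_linear T by fact
  show ?thesis by (induction r arbitrary: f) (simp_all flip: add scaleR)
qed

lemmas expect_untouched_cmult =
  expect_untouched_bounded_linear[OF bounded_linear_mult_right]

lemma expect_untouched_diff:
  "expect_untouched n r (\<lambda>m. f m - g m) = expect_untouched n r f - expect_untouched n r g"
  using expect_untouched_add[of n r "\<lambda>m. f m - g m" g] by simp

lemma expect_untouched_const [simp]: "expect_untouched n r (\<lambda>m. c) = c"
  by (induction r) (simp_all flip: scaleR_add_left)

text \<open>For \<open>m \<le> n\<close> the weights \<open>m / n\<close> and
  \<open>1 - m / n\<close> are nonnegative, so each step is an average and the triangle inequality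
  passes through it.\<close>

lemma expect_untouched_norm_le:
  assumes "\<And>m. m \<le> n \<Longrightarrow> norm (g m) \<le> h m"
  shows "norm (expect_untouched n r g) \<le> expect_untouched n r h"
  using assms
proof (induction r arbitrary: g h)
  case (Suc r)
  show ?case
    unfolding expect_untouched.simps
  proof (rule Suc.IH)
    fix m assume m: "m \<le> n"
    then have p: "0 \<le> real m / real n" "0 \<le> 1 - real m / real n"
      by (auto simp: divide_le_eq_1)
    have "norm (g (m - 1)) \<le> h (m - 1)" "norm (g m) \<le> h m" using m Suc.prems by auto
    then show "norm ((real m / real n) *\<^sub>R g (m - 1) + (1 - real m / real n) *\<^sub>R g m)
        \<le> (real m / real n) *\<^sub>R h (m - 1) + (1 - real m / real n) *\<^sub>R h m"
      unfolding real_scaleR_def using p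
      by (intro norm_triangle_le add_mono)
        (simp_all only: norm_scaleR abs_of_nonneg mult_left_mono)
  qed
qed simp

lemma expect_untouched_mono:
  fixes f g :: "nat \<Rightarrow> real"
  assumes "\<And>m. m \<le> n \<Longrightarrow> f m \<le> g m"
  shows "expect_untouched n r f \<le> expect_untouched n r g"
proof -
  have "norm (expect_untouched n r (\<lambda>m. g m - f m)) \<le> expect_untouched n r (\<lambda>m. g m - f m)"
    by (rule expect_untouched_norm_le) (use assms in auto)
  then have "0 \<le> expect_untouched n r (\<lambda>m. g m - f m)"
    using norm_ge_zero order_trans by blast
  then show ?thesis by (simp add: expect_untouched_diff)
qed

text \<open>The identity is an eigenfunction of the one-step operator, with eigenvalue
  \<open>1 - 1 / n\<close>.\<close>

lemma expect_untouched_mean: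
  assumes "n \<ge> 1"
  shows "expect_untouched n r real = real n * (1 - 1 / real n) ^ r"
proof (induction r)
  case (Suc r)
  have "expect_untouched n (Suc r) real = expect_untouched n r (\<lambda>m. (1 - 1 / real n) * real m)"
    unfolding expect_untouched.simps
  proof (rule expect_untouched_cong)
    fix m assume "m \<le> n"
    then show "(real m / real n) *\<^sub>R real (m - 1) + (1 - real m / real n) *\<^sub>R real m
        = (1 - 1 / real n) * real m"
      using assms by (cases m) (auto simp: field_simps)
  qed
  then show ?case using Suc by (simp add: expect_untouched_cmult)
qed simp

text \<open>The second moment is taken in factorial form because \<open>m * (m - 1)\<close> is again
  an eigenfunction of the one-step operator, now with eigenvalue \<open>1 - 2 / n\<close>.\<close>

lemma expect_untouched_pairs:
  assumes "n \<ge> 1"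
  shows "expect_untouched n r (\<lambda>m. real m * (real m - 1)) = real n * (real n - 1) * (1 - 2 / real n) ^ r"
proof (induction r)
  case (Suc r)
  have "expect_untouched n (Suc r) (\<lambda>m. real m * (real m - 1)) =
      expect_untouched n r (\<lambda>m. (1 - 2 / real n) * (real m * (real m - 1)))"
    unfolding expect_untouched.simps
  proof (rule expect_untouched_cong)
    fix m assume "m \<le> n"
    then show "(real m / real n) *\<^sub>R (real (m - 1) * (real (m - 1) - 1))
        + (1 - real m / real n) *\<^sub>R (real m * (real m - 1)) = (1 - 2 / real n) * (real m * (real m - 1))"
      using assms by (cases m) (auto simp: field_simps)
  qed
  then show ?case using Suc by (simp add: expect_untouched_cmult)
qed simp

text \<open>Expressed by the two preceding moments, the variance is at most \<mu>: the inequality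
  \<open>1 - 2 / n \<le> (1 - 1 / n)\<^sup>2\<close> bounds the factorial moment by the square of
  the mean. Finally \<mu> is at most \<open>n\<close>.\<close>

lemma expect_untouched_variance_le:
  fixes n r :: nat
  assumes "n \<ge> 2"
  defines "\<mu> \<equiv> real n * (1 - 1 / real n) ^ r"
  shows "expect_untouched n r (\<lambda>m. (real m - \<mu>)\<^sup>2) \<le> real n"
proof -
  define \<rho> where "\<rho> = 1 - 1 / real n"
  have \<rho>: "0 \<le> \<rho>" "\<rho> \<le> 1" using assms by (auto simp: \<rho>_def)
  have \<mu>: "0 \<le> \<mu>" "\<mu> \<le> real n"
    using \<rho> power_le_one[OF \<rho>] by (auto simp: \<mu>_def \<rho>_def[symmetric] mult_left_le)
  have "expect_untouched n r (\<lambda>m. (real m - \<mu>)\<^sup>2) =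
     expect_untouched n r (\<lambda>m. (real m * (real m - 1) + (1 - 2 * \<mu>) * real m) + \<mu>\<^sup>2)"
    by (simp add: power2_eq_square algebra_simps)
  also have "\<dots> = real n * (real n - 1) * (1 - 2 / real n) ^ r + (1 - 2 * \<mu>) * \<mu> + \<mu>\<^sup>2"
    using assms(1) by (simp add: expect_untouched_add expect_untouched_cmult expect_untouched_pairs
        expect_untouched_mean \<mu>_def)
  also have "real n * (real n - 1) * (1 - 2 / real n) ^ r \<le> (real n * real n) * (\<rho>\<^sup>2) ^ r"
  proof (intro mult_mono power_mono)
    show "1 - 2 / real n \<le> \<rho>\<^sup>2" by (simp add: \<rho>_def power2_eq_square algebra_simps)
  qed (use assms(1) in \<open>auto simp: divide_le_eq\<close>)
  also have "\<dots> = \<mu>\<^sup>2"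
    by (simp add: \<mu>_def \<rho>_def[symmetric] power_mult_distrib power2_eq_square)
  also have "\<mu>\<^sup>2 + (1 - 2 * \<mu>) * \<mu> + \<mu>\<^sup>2 = \<mu>"
    by (simp add: power2_eq_square algebra_simps)
  finally show ?thesis using \<mu> by simp
qed

text \<open>The inequality of arithmetic and geometric means with weight \<open>sqrt n\<close>
  stands in for Cauchy-Schwarz and reduces the absolute deviation to the variance bound.\<close>

lemma expect_untouched_abs_deviation_le:
  fixes n r :: nat
  assumes "n \<ge> 2"
  defines "q \<equiv> (1 - 1 / real n) ^ r"
  shows "expect_untouched n r (\<lambda>m. \<bar>real m / real n - q\<bar>) \<le> 1 / sqrt (real n)"
proof -
  define \<mu> where "\<mu> = real n * q"
  have s: "sqrt (real n) > 0" "sqrt (real n) * sqrt (real n) = real n" using assms by auto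
  have "expect_untouched n r (\<lambda>m. \<bar>real m / real n - q\<bar>) \<le>
     expect_untouched n r (\<lambda>m. 1 / (2 * real n * sqrt (real n)) * (real m - \<mu>)\<^sup>2 + 1 / (2 * sqrt (real n)))"
  proof (rule expect_untouched_mono)
    fix m assume "m \<le> n"
    have "0 \<le> (\<bar>real m - \<mu>\<bar> - sqrt (real n))\<^sup>2" by simp
    then have "2 * \<bar>real m - \<mu>\<bar> * sqrt (real n) \<le> (real m - \<mu>)\<^sup>2 + real n"
      using s by (simp add: power2_diff)
    then have "\<bar>real m - \<mu>\<bar> \<le> ((real m - \<mu>)\<^sup>2 + real n) / (2 * sqrt (real n))"
      using s by (simp add: field_simps)
    then have "\<bar>real m - \<mu>\<bar> / real n \<le> ((real m - \<mu>)\<^sup>2 + real n) / (2 * sqrt (real n)) / real n"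
      by (rule divide_right_mono) simp
    also have "((real m - \<mu>)\<^sup>2 + real n) / (2 * sqrt (real n)) / real n =
      1 / (2 * real n * sqrt (real n)) * (real m - \<mu>)\<^sup>2 + 1 / (2 * sqrt (real n))"
      using assms(1) by (simp add: add_divide_distrib mult.commute)
    also have "\<bar>real m - \<mu>\<bar> / real n = \<bar>real m / real n - q\<bar>"
      using assms(1) by (simp add: \<mu>_def abs_div_pos diff_divide_distrib)
    finally show "\<bar>real m / real n - q\<bar> \<le> 1 / (2 * real n * sqrt (real n)) * (real m - \<mu>)\<^sup>2 + 1 / (2 * sqrt (real n))" .
  qed
  also have "\<dots> = 1 / (2 * real n * sqrt (real n)) * expect_untouched n r (\<lambda>m. (real m - \<mu>)\<^sup>2) + 1 / (2 * sqrt (real n))"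
    by (simp only: expect_untouched_add expect_untouched_cmult expect_untouched_const)
  also have "\<dots> \<le> 1 / (2 * real n * sqrt (real n)) * real n + 1 / (2 * sqrt (real n))"
    using expect_untouched_variance_le[OF assms(1), of r]
    by (intro add_right_mono mult_left_mono) (auto simp: \<mu>_def q_def)
  also have "\<dots> = 1 / sqrt (real n)"
    using assms(1) by (simp add: field_simps)
  finally show ?thesis .
qed

section \<open>Characteristic functions\<close>

lemma cmod_iexp_diff_le: "cmod (iexp a - iexp b) \<le> \<bar>a - b\<bar>"
proof -
  have "iexp a - iexp b = iexp b * (iexp (a - b) - 1)"
    by (simp add: algebra_simps flip: exp_add)
  then have "cmod (iexp a - iexp b) = cmod (iexp (a - b) - 1)"
    by (simp add: norm_mult)
  also have "\<dots> \<le> \<bar>a - b\<bar>" using iexp_approx1[of "a - b" 0] by simp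
  finally show ?thesis .
qed

lemma cmod_iexp_quadratic_le: "cmod (iexp x - (1 + \<i> * x - x\<^sup>2 / 2)) \<le> \<bar>x\<bar> ^ 3 / 6"
proof -
  have "(\<Sum>k\<le>2. (\<i> * complex_of_real x) ^ k / fact k) = 1 + \<i> * x - x\<^sup>2 / 2"
    by (simp add: numeral_2_eq_2 power2_eq_square fact_numeral algebra_simps)
  then show ?thesis
    using iexp_approx1[of x 2] by (simp add: fact_numeral eval_nat_numeral)
qed

lemma abs_exp_minus_diff_le:
  fixes a b :: real
  assumes "0 \<le> a" "0 \<le> b"
  shows "\<bar>exp (- a) - exp (- b)\<bar> \<le> \<bar>a - b\<bar>"
proof -
  have *: "exp (- a) - exp (- b) \<le> b - a" if "0 \<le> a" "a \<le> b" for a b :: real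
  proof -
    have "exp (- a) - exp (- b) = exp (- a) * (1 - exp (- (b - a)))"
      by (simp add: algebra_simps flip: exp_add)
    also have "\<dots> \<le> 1 * (b - a)"
    proof (intro mult_mono)
      show "1 - exp (- (b - a)) \<le> b - a"
        using exp_ge_add_one_self[of "- (b - a)"] by linarith
    qed (use that in auto)
    finally show ?thesis by simp
  qed
  show ?thesis using assms *[of a b] *[of b a] by (cases "a \<le> b") auto
qed

lemma abs_exp_minus_linear_le:
  fixes y :: real
  assumes "0 \<le> y"
  shows "\<bar>exp (- y) - (1 - y)\<bar> \<le> y\<^sup>2"
proof (cases "y \<le> 1")
  case True
  have "exp (- y) \<le> 1 / (1 + y)"
    using assms exp_ge_add_one_self[of y] by (simp add: exp_minus field_simps)
  also have "\<dots> \<le> 1 - y + y\<^sup>2"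
  proof -
    have "1 \<le> (1 - y + y\<^sup>2) * (1 + y)" using assms by (simp add: power2_eq_square algebra_simps)
    then show ?thesis using assms by (simp add: divide_le_eq)
  qed
  finally show ?thesis using exp_ge_add_one_self[of "- y"] by simp
next
  case False
  have "exp (- y) \<le> 1" using assms by simp
  moreover have "y * 1 \<le> y * y" using False by (intro mult_left_mono) auto
  ultimately show ?thesis using exp_ge_add_one_self[of "- y"]
    unfolding power2_eq_square by linarith
qed

text \<open>The mixture is the characteristic function of a centred Bernoulli variable, which takes
  the value \<open>p - 1\<close> with probability \<open>p\<close>; it is compared with a Gaussian
  of variance \<open>q * (1 - q)\<close>. The three error terms come from the Taylor remainder, from
  \<open>exp (- y)\<close> against \<open>1 - y\<close>, and from exchanging \<open>p\<close> for
  \<open>q\<close>. Later \<open>p\<close> is the random fraction \<open>m / n\<close> and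
  \<open>q\<close> its mean.\<close>

lemma cmod_bernoulli_char_le:
  fixes p q t :: real
  assumes p: "0 \<le> p" "p \<le> 1" and q: "0 \<le> q" "q \<le> 1"
  shows "cmod (p * iexp (t * (p - 1)) + (1 - p) * iexp (t * p) - exp (- (t\<^sup>2 * (q * (1 - q)) / 2)))
    \<le> \<bar>t\<bar> ^ 3 + t ^ 4 + t\<^sup>2 * \<bar>p - q\<bar>"
proof -
  define y where "y = t\<^sup>2 * (p * (1 - p)) / 2"
  have pp: "0 \<le> p * (1 - p)" "p * (1 - p) \<le> 1" using p mult_le_one[of p "1 - p"] by auto
  have qq: "0 \<le> q * (1 - q)" using q by auto
  have y: "0 \<le> y" "y \<le> t\<^sup>2"
  proof -
    have "t\<^sup>2 * (p * (1 - p)) \<le> t\<^sup>2 * 1" by (rule mult_left_mono[OF pp(2)]) simp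
    moreover have "0 \<le> t\<^sup>2 * (p * (1 - p))" using pp by simp
    ultimately show "0 \<le> y" "y \<le> t\<^sup>2" unfolding y_def by linarith+
  qed
  let ?P = "\<lambda>x::real. 1 + \<i> * x - x\<^sup>2 / 2 :: complex"
  \<comment> \<open>Centring kills the linear term, and the second moment is
    \<open>p * (1 - p)\<close>.\<close>
  have split: "complex_of_real p * ?P (t * (p - 1)) + (1 - complex_of_real p) * ?P (t * p) = complex_of_real (1 - y)"
    by (simp add: y_def power2_eq_square field_simps)
  have R: "\<bar>t * x\<bar> ^ 3 / 6 \<le> \<bar>t\<bar> ^ 3" if "\<bar>x\<bar> \<le> 1" for x :: real
  proof -
    have "\<bar>t * x\<bar> ^ 3 = \<bar>t\<bar> ^ 3 * \<bar>x\<bar> ^ 3" by (simp add: abs_mult power_mult_distrib)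
    also have "\<dots> \<le> \<bar>t\<bar> ^ 3 * 1" using that by (intro mult_left_mono power_le_one) auto
    finally have "\<bar>t * x\<bar> ^ 3 \<le> \<bar>t\<bar> ^ 3" by simp
    moreover have "0 \<le> \<bar>t\<bar> ^ 3" by simp
    ultimately show ?thesis by linarith
  qed
  have "cmod (p * iexp (t * (p - 1)) + (1 - p) * iexp (t * p) - complex_of_real (1 - y)) =
    cmod (complex_of_real p * (iexp (t * (p - 1)) - ?P (t * (p - 1)))
      + complex_of_real (1 - p) * (iexp (t * p) - ?P (t * p)))"
    unfolding split[symmetric] by (simp add: algebra_simps)
  also have "\<dots> \<le> p * \<bar>t\<bar> ^ 3 + (1 - p) * \<bar>t\<bar> ^ 3"
  proof (intro norm_triangle_le add_mono)
    have "cmod (iexp (t * (p - 1)) - ?P (t * (p - 1))) \<le> \<bar>t\<bar> ^ 3"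
      using cmod_iexp_quadratic_le[of "t * (p - 1)"] R[of "p - 1"] p by (simp del: of_real_mult of_real_diff)
    then show "cmod (complex_of_real p * (iexp (t * (p - 1)) - ?P (t * (p - 1)))) \<le> p * \<bar>t\<bar> ^ 3"
      unfolding norm_mult norm_of_real using p by (simp only: abs_of_nonneg mult_left_mono)
    have "cmod (iexp (t * p) - ?P (t * p)) \<le> \<bar>t\<bar> ^ 3"
      using cmod_iexp_quadratic_le[of "t * p"] R[of p] p by (simp del: of_real_mult)
    moreover have "0 \<le> 1 - p" using p by simp
    ultimately show "cmod (complex_of_real (1 - p) * (iexp (t * p) - ?P (t * p))) \<le> (1 - p) * \<bar>t\<bar> ^ 3"
      unfolding norm_mult norm_of_real by (simp only: abs_of_nonneg mult_left_mono)
  qed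
  also have "\<dots> = \<bar>t\<bar> ^ 3" by (simp add: algebra_simps)
  finally have 1: "cmod (p * iexp (t * (p - 1)) + (1 - p) * iexp (t * p) - complex_of_real (1 - y)) \<le> \<bar>t\<bar> ^ 3" .
  have "\<bar>exp (- y) - (1 - y)\<bar> \<le> y\<^sup>2" by (rule abs_exp_minus_linear_le[OF y(1)])
  also have "y\<^sup>2 \<le> (t\<^sup>2)\<^sup>2" using y by (intro power_mono)
  finally have 2: "\<bar>exp (- y) - (1 - y)\<bar> \<le> t ^ 4" by simp
  have "\<bar>exp (- y) - exp (- (t\<^sup>2 * (q * (1 - q)) / 2))\<bar> \<le> \<bar>y - t\<^sup>2 * (q * (1 - q)) / 2\<bar>"
    using y qq by (intro abs_exp_minus_diff_le) auto
  \<comment> \<open>Exchanging \<open>p\<close> for \<open>q\<close> changes the variance by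
    \<open>(p - q) * (1 - p - q)\<close>, whose second factor is at most 1 in absolute
    value.\<close>
  also have "y - t\<^sup>2 * (q * (1 - q)) / 2 = (t\<^sup>2 * (p - q)) * ((1 - p - q) / 2)"
    by (simp add: y_def power2_eq_square field_simps)
  also have "\<bar>\<dots>\<bar> = t\<^sup>2 * \<bar>p - q\<bar> * (\<bar>1 - p - q\<bar> / 2)" by (simp add: abs_mult)
  also have "\<dots> \<le> t\<^sup>2 * \<bar>p - q\<bar> * 1" using p q by (intro mult_left_mono) auto
  finally have 3: "\<bar>exp (- y) - exp (- (t\<^sup>2 * (q * (1 - q)) / 2))\<bar> \<le> t\<^sup>2 * \<bar>p - q\<bar>" by simp
  have "\<bar>(1 - y) - exp (- (t\<^sup>2 * (q * (1 - q)) / 2))\<bar> \<le> t ^ 4 + t\<^sup>2 * \<bar>p - q\<bar>"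
    using 2 3 by linarith
  then have "cmod (complex_of_real (1 - y) - complex_of_real (exp (- (t\<^sup>2 * (q * (1 - q)) / 2)))) \<le> t ^ 4 + t\<^sup>2 * \<bar>p - q\<bar>"
    by (simp only: norm_of_real flip: of_real_diff)
  from norm_triangle_le[OF add_mono[OF 1 this]] show ?thesis
    by (simp add: algebra_simps)
qed

section \<open>Gaussian approximation for discrete uniform variables\<close>

lemma sum_centered_squares:
  "(\<Sum>j\<le>l. (real j - real l / 2)) = 0"
  "(\<Sum>j\<le>l. (real j - real l / 2)\<^sup>2) = real (Suc l) * ((real l)\<^sup>2 + 2 * real l) / 12"
proof -
  have 1: "(\<Sum>j\<le>l. real j) = real l * (real l + 1) / 2"
    by (induction l) (simp_all add: field_simps)
  have 2: "(\<Sum>j\<le>l. (real j)\<^sup>2) = real l * (real l + 1) * (2 * real l + 1) / 6"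
    by (induction l) (simp_all add: field_simps power2_eq_square)
  show "(\<Sum>j\<le>l. (real j - real l / 2)) = 0"
    by (simp add: sum_subtractf 1)
  have "(\<Sum>j\<le>l. (real j - real l / 2)\<^sup>2) = (\<Sum>j\<le>l. (real j)\<^sup>2 - real l * real j + (real l)\<^sup>2 / 4)"
    by (intro sum.cong refl) (simp add: power2_eq_square field_simps)
  also have "\<dots> = real l * (real l + 1) * (2 * real l + 1) / 6 - real l * (real l * (real l + 1) / 2)
     + real (Suc l) * ((real l)\<^sup>2 / 4)"
    by (simp add: sum.distrib sum_subtractf 1 2 flip: sum_distrib_left)
  also have "\<dots> = real (Suc l) * ((real l)\<^sup>2 + 2 * real l) / 12"
    by (simp add: power2_eq_square field_simps)
  finally show "(\<Sum>j\<le>l. (real j - real l / 2)\<^sup>2) = real (Suc l) * ((real l)\<^sup>2 + 2 * real l) / 12" .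
qed

lemma norm_uniform_char_le: "cmod (uniform_char l s) \<le> 1"
proof -
  have "cmod (\<Sum>j\<le>l. iexp (s * real j)) \<le> (\<Sum>j\<le>l. cmod (iexp (s * real j)))" by (rule norm_sum)
  also have "\<dots> = real (Suc l)" by (simp del: of_real_mult of_real_of_nat_eq)
  finally show ?thesis by (simp add: uniform_char_def norm_divide del: of_nat_Suc)
qed

text \<open>Taking out the phase of the mean \<open>l / 2\<close> leaves a centred variable of
  variance \<open>(l\<^sup>2 + 2 * l) / 12\<close>. A quadratic Taylor expansion of each term gives
  the cubic error, and passing from \<open>1 - y\<close> to \<open>exp (- y)\<close> the quartic
  one.\<close>

lemma cmod_uniform_char_le:
  "cmod (uniform_char l s - iexp (s * real l / 2) * exp (- (s\<^sup>2 * ((real l)\<^sup>2 + 2 * real l) / 24)))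
    \<le> \<bar>s\<bar> ^ 3 * real (Suc l) ^ 3 + s ^ 4 * real (Suc l) ^ 4"
proof -
  define x where "x j = s * (real j - real l / 2)" for j
  define y where "y = s\<^sup>2 * ((real l)\<^sup>2 + 2 * real l) / 24"
  define v where "v = (\<Sum>j\<le>l. iexp (x j)) / of_nat (Suc l)"
  let ?P = "\<lambda>x::real. 1 + \<i> * x - x\<^sup>2 / 2 :: complex"
  have u: "uniform_char l s = iexp (s * real l / 2) * v"
  proof -
    have "iexp (s * real j) = iexp (s * real l / 2) * iexp (x j)" for j
      unfolding exp_add[symmetric] by (simp add: x_def algebra_simps)
    then show ?thesis
      unfolding uniform_char_def v_def times_divide_eq_right sum_distrib_left by (simp only:)
  qed
  have "(\<Sum>j\<le>l. x j) = 0" "(\<Sum>j\<le>l. (x j)\<^sup>2) = real (Suc l) * (2 * y)"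
    unfolding x_def power_mult_distrib sum_distrib_left[symmetric] sum_centered_squares y_def by simp_all
  moreover have "(\<Sum>j\<le>l. ?P (x j)) = of_nat (Suc l) + \<i> * complex_of_real (\<Sum>j\<le>l. x j)
      - complex_of_real (\<Sum>j\<le>l. (x j)\<^sup>2) / 2"
    by (simp add: sum.distrib sum_subtractf sum_distrib_left sum_divide_distrib)
  ultimately have "(\<Sum>j\<le>l. ?P (x j)) = of_nat (Suc l) * complex_of_real (1 - y)"
    by (simp only:) (simp add: algebra_simps)
  then have sumP: "complex_of_real (1 - y) = (\<Sum>j\<le>l. ?P (x j)) / of_nat (Suc l)"
    by (simp add: field_simps del: of_nat_Suc)
  have "cmod (\<Sum>j\<le>l. iexp (x j) - ?P (x j)) \<le> (\<Sum>j\<le>l. \<bar>s\<bar> ^ 3 * real (Suc l) ^ 3)"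
  proof (rule sum_norm_le)
    fix j assume "j \<in> {..l}"
    then have "\<bar>x j\<bar> \<le> \<bar>s\<bar> * real (Suc l)"
      unfolding x_def abs_mult by (intro mult_left_mono) auto
    then have "\<bar>x j\<bar> ^ 3 \<le> (\<bar>s\<bar> * real (Suc l)) ^ 3" by (intro power_mono) auto
    moreover have "0 \<le> \<bar>x j\<bar> ^ 3" by simp
    moreover have "cmod (iexp (x j) - ?P (x j)) \<le> \<bar>x j\<bar> ^ 3 / 6" using cmod_iexp_quadratic_le[of "x j"] by simp
    ultimately show "cmod (iexp (x j) - ?P (x j)) \<le> \<bar>s\<bar> ^ 3 * real (Suc l) ^ 3"
      unfolding power_mult_distrib by linarith
  qed
  then have "cmod ((\<Sum>j\<le>l. iexp (x j) - ?P (x j)) / of_nat (Suc l)) \<le> \<bar>s\<bar> ^ 3 * real (Suc l) ^ 3"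
    unfolding norm_divide norm_of_nat by (simp add: divide_le_eq mult.commute del: of_nat_Suc)
  then have 1: "cmod (v - complex_of_real (1 - y)) \<le> \<bar>s\<bar> ^ 3 * real (Suc l) ^ 3"
    unfolding v_def sumP by (simp add: sum_subtractf diff_divide_distrib del: of_nat_Suc)
  have y: "0 \<le> y" "y \<le> s\<^sup>2 * (real (Suc l))\<^sup>2"
  proof -
    have "s\<^sup>2 * ((real l)\<^sup>2 + 2 * real l) \<le> s\<^sup>2 * (real (Suc l))\<^sup>2"
      by (intro mult_left_mono) (auto simp: power2_eq_square algebra_simps)
    moreover have "0 \<le> s\<^sup>2 * ((real l)\<^sup>2 + 2 * real l)" by simp
    ultimately show "y \<le> s\<^sup>2 * (real (Suc l))\<^sup>2" unfolding y_def by linarith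
  qed (simp add: y_def)
  have "\<bar>exp (- y) - (1 - y)\<bar> \<le> y\<^sup>2" by (rule abs_exp_minus_linear_le[OF y(1)])
  also have "y\<^sup>2 \<le> (s\<^sup>2 * (real (Suc l))\<^sup>2)\<^sup>2" using y by (intro power_mono)
  finally have "\<bar>(1 - y) - exp (- y)\<bar> \<le> s ^ 4 * real (Suc l) ^ 4"
    by (simp add: power_mult_distrib abs_minus_commute)
  then have "cmod (complex_of_real (1 - y) - complex_of_real (exp (- y))) \<le> s ^ 4 * real (Suc l) ^ 4"
    by (simp only: norm_of_real flip: of_real_diff)
  from norm_triangle_le[OF add_mono[OF 1 this]]
  have "cmod (v - complex_of_real (exp (- y))) \<le> \<bar>s\<bar> ^ 3 * real (Suc l) ^ 3 + s ^ 4 * real (Suc l) ^ 4"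
    by simp
  moreover have "cmod (iexp (s * real l / 2) * v - iexp (s * real l / 2) * complex_of_real (exp (- y)))
      = cmod (v - complex_of_real (exp (- y)))"
    unfolding right_diff_distrib[symmetric] norm_mult by (simp del: of_real_mult of_real_divide)
  ultimately show ?thesis unfolding u y_def by simp
qed

text \<open>The recursion for the variance of \<open>m\<close>, with the random fraction \<open>m / n\<close> replaced by its mean
  \<open>\<rho> ^ r\<close>, is \<open>V (r + 1) = \<rho>\<^sup>2 V r + \<rho> ^ r (1 - \<rho> ^ r)\<close>; this is its solution with \<open>V 0 = 0\<close>.\<close>

definition untouched_variance :: "nat \<Rightarrow> nat \<Rightarrow> real" where
  "untouched_variance n r = (let \<rho> = 1 - 1 / real n in
     real n / \<rho> * (\<rho> ^ r - (\<rho> ^ r)\<^sup>2) - real r / \<rho>\<^sup>2 * (\<rho> ^ r)\<^sup>2)"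

lemma untouched_variance_Suc:
  fixes n r :: nat
  assumes "n \<ge> 2"
  defines "\<rho> \<equiv> 1 - 1 / real n"
  shows "untouched_variance n (Suc r) = \<rho>\<^sup>2 * untouched_variance n r + \<rho> ^ r * (1 - \<rho> ^ r)"
proof -
  have \<rho>: "\<rho> \<noteq> 0" and n: "real n * (1 - \<rho>) = 1" using assms(1) by (auto simp: \<rho>_def field_simps)
  define x where "x = \<rho> ^ r"
  \<comment> \<open>The link between \<open>n\<close> and \<rho> is
    \<open>n * (1 - \<rho>) = 1\<close>; in this form it accounts for the increment of the
    recursion.\<close>
  have "real n * x = (real n * (1 - \<rho>)) * x + real n * \<rho> * x" by (simp add: algebra_simps)
  then have nx: "real n * x = x + real n * \<rho> * x" unfolding n by simp
  have L: "untouched_variance n (Suc r) = real n * x - real n * \<rho> * x\<^sup>2 - (real r + 1) * x\<^sup>2"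
    using \<rho> by (simp add: untouched_variance_def Let_def \<rho>_def[symmetric] x_def[symmetric] field_simps power2_eq_square)
  have R: "\<rho>\<^sup>2 * untouched_variance n r = real n * \<rho> * (x - x\<^sup>2) - real r * x\<^sup>2"
    using \<rho> by (simp add: untouched_variance_def Let_def \<rho>_def[symmetric] x_def[symmetric] field_simps power2_eq_square)
  show ?thesis unfolding L R x_def[symmetric] using nx by (simp add: algebra_simps power2_eq_square)
qed

text \<open>One step turns \<open>t\<close> into \<open>\<rho> * t\<close>, hence the induction over
  all \<open>t\<close>. Given \<open>m\<close>, the fluctuation of the step is centred Bernoulli
  with parameter \<open>m / n\<close>. Replacing it by the Gaussian factor for the mean fraction
  \<open>\<rho> ^ r\<close> costs \<open>t\<^sup>2\<close> times the mean deviation, of order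
  \<open>1 / sqrt n\<close>, plus higher powers of \<open>t\<close>. The errors of the
  \<open>r\<close> steps add up.\<close>

lemma char_untouched_approx:
  fixes n r :: nat and t :: real
  assumes n: "n \<ge> 2"
  shows "cmod (expect_untouched n r (\<lambda>m. iexp (t * (real m - real n * (1 - 1 / real n) ^ r)))
      - exp (- (t\<^sup>2 * untouched_variance n r / 2)))
    \<le> real r * (\<bar>t\<bar> ^ 3 + t ^ 4 + t\<^sup>2 / sqrt (real n))"
proof (induction r arbitrary: t)
  case 0
  show ?case by (simp add: untouched_variance_def)
next
  case (Suc r)
  define \<rho> where "\<rho> = 1 - 1 / real n"
  have \<rho>: "0 \<le> \<rho>" "\<rho> \<le> 1" using n by (auto simp: \<rho>_def)
  define q where "q = \<rho> ^ r"
  have q: "0 \<le> q" "q \<le> 1" using \<rho> by (auto simp: q_def power_le_one)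
  define E where "E = exp (- (t\<^sup>2 * (q * (1 - q)) / 2))"
  have E: "0 \<le> E" "E \<le> 1" using q by (auto simp: E_def)
  let ?g = "\<lambda>m. iexp ((\<rho> * t) * (real m - real n * q))"
  define err where "err t = \<bar>t\<bar> ^ 3 + t ^ 4 + t\<^sup>2 / sqrt (real n)" for t :: real
  \<comment> \<open>The linear drift makes this exact: the new deviation from the mean is \<rho>
    times the old one plus a centred Bernoulli variable.\<close>
  have step: "(real m / real n) *\<^sub>R iexp (t * (real (m - 1) - real n * \<rho> ^ Suc r))
      + (1 - real m / real n) *\<^sub>R iexp (t * (real m - real n * \<rho> ^ Suc r))
     = ?g m * (complex_of_real (real m / real n) * iexp (t * (real m / real n - 1))
         + (1 - complex_of_real (real m / real n)) * iexp (t * (real m / real n)))" for m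
  proof -
    have a: "iexp (t * (real m - real n * \<rho> ^ Suc r)) = ?g m * iexp (t * (real m / real n))"
    proof -
      have "t * (real m - real n * \<rho> ^ Suc r) = (\<rho> * t) * (real m - real n * q) + t * (real m / real n)"
        using n by (simp add: q_def \<rho>_def field_simps)
      then show ?thesis by (simp only: of_real_add distrib_left exp_add)
    qed
    have b: "iexp (t * (real m - 1 - real n * \<rho> ^ Suc r)) = ?g m * iexp (t * (real m / real n - 1))"
    proof -
      have "t * (real m - 1 - real n * \<rho> ^ Suc r) = (\<rho> * t) * (real m - real n * q) + t * (real m / real n - 1)"
        using n by (simp add: q_def \<rho>_def field_simps)
      then show ?thesis by (simp only: of_real_add distrib_left exp_add)
    qed
    \<comment> \<open>At \<open>m = 0\<close> the truncated \<open>m - 1\<close> is harmless, as its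
      weight is zero.\<close>
    show ?thesis
    proof (cases "m = 0")
      case True
      then show ?thesis using a by simp
    next
      case False
      then have "real (m - 1) = real m - 1" by simp
      then show ?thesis unfolding a b scaleR_conv_of_real by (simp only: b) (simp add: algebra_simps)
    qed
  qed
  have eq: "expect_untouched n (Suc r) (\<lambda>m. iexp (t * (real m - real n * \<rho> ^ Suc r))) - E * expect_untouched n r ?g
    = expect_untouched n r (\<lambda>m. ?g m * (complex_of_real (real m / real n) * iexp (t * (real m / real n - 1))
         + (1 - complex_of_real (real m / real n)) * iexp (t * (real m / real n)) - E))"
    (is "_ = expect_untouched n r (\<lambda>m. ?g m * (?B m - complex_of_real E))")
  proof -
    have "expect_untouched n r (\<lambda>m. ?g m * (?B m - complex_of_real E)) =
        expect_untouched n r (\<lambda>m. ?g m * ?B m - complex_of_real E * ?g m)"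
      by (rule expect_untouched_cong) (simp only: right_diff_distrib mult.commute)
    also have "\<dots> = expect_untouched n r (\<lambda>m. ?g m * ?B m) - complex_of_real E * expect_untouched n r ?g"
      by (subst expect_untouched_diff, subst expect_untouched_cmult) (rule refl)
    finally show ?thesis
      unfolding expect_untouched.simps step by (rule sym)
  qed
  have "cmod (expect_untouched n (Suc r) (\<lambda>m. iexp (t * (real m - real n * \<rho> ^ Suc r))) - E * expect_untouched n r ?g)
      \<le> expect_untouched n r (\<lambda>m. (\<bar>t\<bar> ^ 3 + t ^ 4) + t\<^sup>2 * \<bar>real m / real n - q\<bar>)"
    unfolding eq
  proof (rule expect_untouched_norm_le)
    fix m assume "m \<le> n"
    then have "0 \<le> real m / real n" "real m / real n \<le> 1" by (auto simp: divide_le_eq_1)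
    from cmod_bernoulli_char_le[OF this q, of t]
    show "cmod (?g m * (complex_of_real (real m / real n) * iexp (t * (real m / real n - 1))
         + (1 - complex_of_real (real m / real n)) * iexp (t * (real m / real n)) - E))
      \<le> (\<bar>t\<bar> ^ 3 + t ^ 4) + t\<^sup>2 * \<bar>real m / real n - q\<bar>"
      unfolding norm_mult norm_exp_i_times E_def by (simp only: mult_1 of_real_diff of_real_1)
  qed
  also have "\<dots> = (\<bar>t\<bar> ^ 3 + t ^ 4) + t\<^sup>2 * expect_untouched n r (\<lambda>m. \<bar>real m / real n - q\<bar>)"
    by (simp only: expect_untouched_add expect_untouched_cmult expect_untouched_const)
  also have "\<dots> \<le> (\<bar>t\<bar> ^ 3 + t ^ 4) + t\<^sup>2 * (1 / sqrt (real n))"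
    using expect_untouched_abs_deviation_le[OF n, of r]
    by (intro add_left_mono mult_left_mono) (auto simp: q_def \<rho>_def)
  finally have 1: "cmod (expect_untouched n (Suc r) (\<lambda>m. iexp (t * (real m - real n * \<rho> ^ Suc r)))
      - E * expect_untouched n r ?g) \<le> err t" by (simp add: err_def)
  have "cmod (expect_untouched n r ?g - exp (- ((\<rho> * t)\<^sup>2 * untouched_variance n r / 2))) \<le> real r * err (\<rho> * t)"
    using Suc.IH[of "\<rho> * t"] by (simp only: q_def \<rho>_def err_def)
  \<comment> \<open>The error is increasing in \<open>\<bar>t\<bar>\<close> and \<rho> is at most 1,
    so rescaling does not enlarge the accumulated error.\<close>
  also have "\<dots> \<le> real r * err t"
  proof -
    have "\<bar>\<rho> * t\<bar> \<le> \<bar>t\<bar>" using \<rho> by (simp add: abs_mult mult_left_le_one_le)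
    then have "\<bar>\<rho> * t\<bar> ^ k \<le> \<bar>t\<bar> ^ k" for k by (intro power_mono) auto
    from this[of 3] this[of 4] this[of 2] show ?thesis
      unfolding err_def by (intro mult_left_mono add_mono divide_right_mono) auto
  qed
  finally have IH: "cmod (expect_untouched n r ?g - exp (- ((\<rho> * t)\<^sup>2 * untouched_variance n r / 2))) \<le> real r * err t" .
  \<comment> \<open>The recursion of \<open>untouched_variance\<close> is exactly what makes the
    Gaussian factors multiply without a further error.\<close>
  have "exp (- (t\<^sup>2 * untouched_variance n (Suc r) / 2)) = E * exp (- ((\<rho> * t)\<^sup>2 * untouched_variance n r / 2))"
    unfolding untouched_variance_Suc[OF n, of r, folded \<rho>_def, folded q_def] E_def
    by (simp add: field_simps power_mult_distrib flip: exp_add)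
  then have "cmod (E * expect_untouched n r ?g - exp (- (t\<^sup>2 * untouched_variance n (Suc r) / 2)))
    = E * cmod (expect_untouched n r ?g - exp (- ((\<rho> * t)\<^sup>2 * untouched_variance n r / 2)))"
    using E by (simp only: of_real_mult right_diff_distrib[symmetric] norm_mult norm_of_real abs_of_nonneg)
  also have "\<dots> \<le> 1 * (real r * err t)" using E IH by (intro mult_mono) auto
  finally have 2: "cmod (E * expect_untouched n r ?g - exp (- (t\<^sup>2 * untouched_variance n (Suc r) / 2))) \<le> real r * err t"
    by simp
  have "real (Suc r) * err t = err t + real r * err t" by (simp add: algebra_simps)
  with norm_triangle_le[OF add_mono[OF 1 2]] show ?case
    unfolding \<rho>_def[symmetric] err_def[of t, symmetric] by (simp del: expect_untouched.simps)
qed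

section \<open>Approximation of the normalised inversion number\<close>

lemma sum_half_atLeastLessThan:
  assumes "m \<le> n"
  shows "(\<Sum>l\<in>{m..<n}. real l / 2) = (real n * (real n - 1) - real m * (real m - 1)) / 4"
  using assms by (induction n rule: dec_induct) (simp_all add: field_simps)

lemma sum_variance_atLeastLessThan:
  assumes "m \<le> n"
  shows "(\<Sum>l\<in>{m..<n}. (real l)\<^sup>2 + 2 * real l) =
    real n * (real n - 1) * (2 * real n + 5) / 6 - real m * (real m - 1) * (2 * real m + 5) / 6"
  using assms by (induction n rule: dec_induct) (simp_all add: field_simps power2_eq_square)

text \<open>All factors lie in the unit disc, so the difference of the products is at most the sum
  of the differences. By the scaling of \<open>s\<close>, each of the at most \<open>n\<close>
  differences is of order \<open>n\<close> to the power -3/2.\<close>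

lemma cmod_prod_uniform_char_le:
  fixes n :: nat and t :: real
  assumes mn: "m \<le> n" and n: "n \<ge> 1"
  defines "s \<equiv> t / sqrt (real n) ^ 3"
  shows "cmod ((\<Prod>l\<in>{m..<n}. uniform_char l s) -
      iexp (s * ((real n * (real n - 1) - real m * (real m - 1)) / 4)) *
      exp (- (s\<^sup>2 * (real n * (real n - 1) * (2 * real n + 5) / 6 - real m * (real m - 1) * (2 * real m + 5) / 6) / 24)))
    \<le> (\<bar>t\<bar> ^ 3 + t ^ 4) / sqrt (real n)"
proof -
  define \<sigma> where "\<sigma> = sqrt (real n)"
  have \<sigma>: "\<sigma> > 0" "\<sigma> \<ge> 1" "\<sigma>\<^sup>2 = real n" using n by (auto simp: \<sigma>_def)
  define w where "w l = iexp (s * real l / 2) * complex_of_real (exp (- (s\<^sup>2 * ((real l)\<^sup>2 + 2 * real l) / 24)))" for l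
  have w: "cmod (w l) \<le> 1" for l
    by (simp add: w_def norm_mult del: of_real_mult of_real_divide)
  have prod_w: "(\<Prod>l\<in>{m..<n}. w l) = iexp (s * ((real n * (real n - 1) - real m * (real m - 1)) / 4)) *
      exp (- (s\<^sup>2 * (real n * (real n - 1) * (2 * real n + 5) / 6 - real m * (real m - 1) * (2 * real m + 5) / 6) / 24))"
  proof -
    have "(\<Prod>l\<in>{m..<n}. iexp (s * real l / 2)) = iexp (s * (\<Sum>l\<in>{m..<n}. real l / 2))"
      by (simp add: exp_sum sum_distrib_left)
    moreover have "(\<Prod>l\<in>{m..<n}. exp (- (s\<^sup>2 * ((real l)\<^sup>2 + 2 * real l) / 24))) =
       exp (- (s\<^sup>2 * (\<Sum>l\<in>{m..<n}. (real l)\<^sup>2 + 2 * real l) / 24))"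
      by (simp only: exp_sum[symmetric] finite_atLeastLessThan sum_negf sum_divide_distrib sum_distrib_left)
    ultimately show ?thesis
      unfolding w_def prod.distrib of_real_prod[symmetric] sum_half_atLeastLessThan[OF mn]
        sum_variance_atLeastLessThan[OF mn] by (simp only:)
  qed
  have "cmod ((\<Prod>l\<in>{m..<n}. uniform_char l s) - (\<Prod>l\<in>{m..<n}. w l)) \<le> (\<Sum>l\<in>{m..<n}. cmod (uniform_char l s - w l))"
    by (rule norm_prod_diff) (use norm_uniform_char_le w in auto)
  also have "\<dots> \<le> (\<Sum>l\<in>{m..<n}. \<bar>s\<bar> ^ 3 * real n ^ 3 + s ^ 4 * real n ^ 4)"
  proof (rule sum_mono)
    fix l assume "l \<in> {m..<n}"
    then have "\<bar>s\<bar> ^ 3 * real (Suc l) ^ 3 + s ^ 4 * real (Suc l) ^ 4 \<le> \<bar>s\<bar> ^ 3 * real n ^ 3 + s ^ 4 * real n ^ 4"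
      by (intro add_mono mult_left_mono power_mono) auto
    with cmod_uniform_char_le[of l s] show "cmod (uniform_char l s - w l) \<le> \<bar>s\<bar> ^ 3 * real n ^ 3 + s ^ 4 * real n ^ 4"
      unfolding w_def by linarith
  qed
  also have "\<dots> \<le> real n * (\<bar>s\<bar> ^ 3 * real n ^ 3 + s ^ 4 * real n ^ 4)"
  proof -
    have "0 \<le> \<bar>s\<bar> ^ 3 * real n ^ 3 + s ^ 4 * real n ^ 4" by simp
    then show ?thesis by (simp add: mult_right_mono)
  qed
  also have "\<dots> = \<bar>t\<bar> ^ 3 / \<sigma> + t ^ 4 / \<sigma>\<^sup>2"
    using \<sigma>(1) unfolding \<sigma>(3)[symmetric] s_def \<sigma>_def[symmetric]
    by (simp add: field_simps power_divide abs_divide eval_nat_numeral)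
  also have "\<dots> \<le> \<bar>t\<bar> ^ 3 / \<sigma> + t ^ 4 / \<sigma>"
  proof (intro add_left_mono divide_left_mono)
    show "\<sigma> \<le> \<sigma>\<^sup>2" using \<sigma>(1) mult_left_mono[OF \<sigma>(2), of \<sigma>] by (simp add: power2_eq_square)
  qed (use \<sigma>(1) in auto)
  finally show ?thesis unfolding prod_w \<sigma>_def[symmetric] by (simp add: add_divide_distrib)
qed

text \<open>Each cubic polynomial is a third of a cube up to an error quadratic in \<open>n\<close>,
  and cubing is Lipschitz on the unit interval with constant 3. Up to scaling, this replaces the
  variance of the inversion number given \<open>m\<close> by its leading value at the mean fraction
  \<open>q\<close>.\<close>

lemma abs_cubic_sum_diff_le:
  assumes mn: "m \<le> n" and n: "n \<ge> 1" and q: "0 \<le> q" "q \<le> 1"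
  shows "\<bar>(real n * (real n - 1) * (2 * real n + 5) / 6 - real m * (real m - 1) * (2 * real m + 5) / 6) / real n ^ 3
      - (1 - q ^ 3) / 3\<bar> \<le> 4 / real n + \<bar>real m / real n - q\<bar>"
proof -
  define T where "T k = real k * (real k - 1) * (2 * real k + 5) / 6" for k
  have T: "\<bar>T k - real k ^ 3 / 3\<bar> \<le> 2 * (real n)\<^sup>2" if "k \<le> n" for k
  proof -
    have "T k - real k ^ 3 / 3 = (real k)\<^sup>2 / 2 - 5 * real k / 6"
      by (simp add: T_def eval_nat_numeral field_simps)
    moreover have "real k \<le> (real k)\<^sup>2" by (cases k) (auto simp: power2_eq_square)
    moreover have "(real k)\<^sup>2 \<le> (real n)\<^sup>2" using that by (intro power_mono) auto
    ultimately show ?thesis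
      using zero_le_power2[of "real k"] of_nat_0_le_iff[of k, where 'a = real] by linarith
  qed
  define x where "x = real m / real n"
  have x: "0 \<le> x" "x \<le> 1" using mn by (auto simp: x_def divide_le_eq_1)
  have "\<bar>x ^ 3 - q ^ 3\<bar> = \<bar>x - q\<bar> * (x\<^sup>2 + x * q + q\<^sup>2)"
  proof -
    have "x ^ 3 - q ^ 3 = (x - q) * (x\<^sup>2 + x * q + q\<^sup>2)" by (simp add: eval_nat_numeral algebra_simps)
    then show ?thesis using x q by (simp add: abs_mult)
  qed
  also have "\<dots> \<le> \<bar>x - q\<bar> * 3"
    using x q power_le_one[of x 2] power_le_one[of q 2] mult_le_one[of x q] by (intro mult_left_mono) auto
  finally have 3: "\<bar>x ^ 3 - q ^ 3\<bar> \<le> 3 * \<bar>x - q\<bar>" by simp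
  have "(T n - T m) / real n ^ 3 - (1 - q ^ 3) / 3 =
     ((T n - real n ^ 3 / 3) - (T m - real m ^ 3 / 3)) / real n ^ 3 - (x ^ 3 - q ^ 3) / 3"
    using n by (simp add: x_def field_simps power_divide)
  also have "\<bar>\<dots>\<bar> \<le> \<bar>((T n - real n ^ 3 / 3) - (T m - real m ^ 3 / 3)) / real n ^ 3\<bar> + \<bar>(x ^ 3 - q ^ 3) / 3\<bar>"
    by (rule abs_triangle_ineq4)
  also have "\<bar>((T n - real n ^ 3 / 3) - (T m - real m ^ 3 / 3)) / real n ^ 3\<bar> \<le> 4 * (real n)\<^sup>2 / real n ^ 3"
  proof -
    have "\<bar>(T n - real n ^ 3 / 3) - (T m - real m ^ 3 / 3)\<bar> \<le> 4 * (real n)\<^sup>2"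
      using T[of n] T[OF mn] by linarith
    then show ?thesis unfolding abs_divide by (simp add: divide_right_mono)
  qed
  also have "4 * (real n)\<^sup>2 / real n ^ 3 = 4 / real n" using n by (simp add: eval_nat_numeral)
  also have "\<bar>(x ^ 3 - q ^ 3) / 3\<bar> \<le> \<bar>x - q\<bar>" using 3 by simp
  finally show ?thesis unfolding T_def x_def by simp
qed

text \<open>Bernoulli's inequality bounds \<open>1 + r / n\<close> by
  \<open>(1 + 1 / n) ^ r\<close>, whose product with \<open>(1 - 1 / n) ^ r\<close> is at most 1.
  This tames the factor \<open>r\<close> in the error of
  \<open>char_untouched_approx\<close>.\<close>

lemma mult_power_le:
  assumes "n \<ge> 1"
  shows "real r * (1 - 1 / real n) ^ r \<le> real n"
proof -
  have n: "real n > 0" using assms by simp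
  have b: "(1 - 1 / real n) * (1 + 1 / real n) \<le> 1" by (simp add: algebra_simps)
  have "(1 - 1 / real n) ^ r * (1 + 1 / real n) ^ r \<le> 1"
    unfolding power_mult_distrib[symmetric] using assms b by (intro power_le_one) (auto simp: divide_le_eq_1)
  moreover have "1 + real r * (1 / real n) \<le> (1 + 1 / real n) ^ r"
    by (rule Bernoulli_inequality) (use n in \<open>auto intro: order_trans[of _ 0]\<close>)
  then have "(1 - 1 / real n) ^ r * (1 + real r * (1 / real n)) \<le> (1 - 1 / real n) ^ r * (1 + 1 / real n) ^ r"
    using assms by (intro mult_left_mono) (auto simp: divide_le_eq_1)
  moreover have "0 \<le> (1 - 1 / real n) ^ r" using assms by (auto simp: divide_le_eq_1)
  ultimately have "(1 - 1 / real n) ^ r * (real r * (1 / real n)) \<le> 1" by (simp add: algebra_simps)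
  then show ?thesis using n by (simp add: field_simps)
qed

lemma cmod_polar_diff_le:
  assumes "0 \<le> u" "0 \<le> v"
  shows "cmod (iexp a * complex_of_real (exp (- u)) - iexp b * complex_of_real (exp (- v))) \<le> \<bar>a - b\<bar> + \<bar>u - v\<bar>"
proof -
  have "iexp a * complex_of_real (exp (- u)) - iexp b * complex_of_real (exp (- v)) =
     (iexp a - iexp b) * complex_of_real (exp (- u)) + iexp b * complex_of_real (exp (- u) - exp (- v))"
    by (simp add: algebra_simps)
  also have "cmod \<dots> \<le> \<bar>a - b\<bar> * 1 + \<bar>u - v\<bar>"
  proof (intro norm_triangle_le add_mono)
    show "cmod ((iexp a - iexp b) * complex_of_real (exp (- u))) \<le> \<bar>a - b\<bar> * 1"
      unfolding norm_mult using assms cmod_iexp_diff_le[of a b] by (intro mult_mono) auto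
    show "cmod (iexp b * complex_of_real (exp (- u) - exp (- v))) \<le> \<bar>u - v\<bar>"
      unfolding norm_mult norm_of_real using abs_exp_minus_diff_le[OF assms] by simp
  qed
  finally show ?thesis by simp
qed

text \<open>Given \<open>m\<close>, the characteristic function is close to a phase times a damping
  factor. The phase, quadratic in \<open>m\<close>, is linearised at the mean \<mu>, and the damping
  is frozen at the mean; \<open>char_untouched_approx\<close> then handles the linear phase. The two
  summands of the variance come from \<open>m\<close> and from the uniform ranks. The last term of
  the bound measures how far the centring \<open>a\<close> is from the leading mean.\<close>

lemma char_inversions_approx:
  fixes n r :: nat and t a :: real
  assumes n: "n \<ge> 2"
  defines "s \<equiv> t / sqrt (real n) ^ 3" and "q \<equiv> (1 - 1 / real n) ^ r"
  shows "cmod (measure_pmf.expectation (inversions_pmf r n) (\<lambda>I. iexp (s * (real I - a)))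
      - exp (- (t\<^sup>2 * (q\<^sup>2 * untouched_variance n r / (4 * real n) + (1 - q ^ 3) / 36) / 2)))
    \<le> (2 * \<bar>t\<bar> ^ 3 + 2 * t ^ 4 + 2 * \<bar>t\<bar> + 3 * t\<^sup>2) / sqrt (real n)
      + \<bar>t\<bar> * \<bar>(a - (real n)\<^sup>2 * (1 - q\<^sup>2) / 4) / sqrt (real n) ^ 3\<bar>"
proof -
  define \<sigma> where "\<sigma> = sqrt (real n)"
  have \<sigma>: "\<sigma> > 0" "\<sigma> \<ge> 1" "\<sigma>\<^sup>2 = real n" using n by (auto simp: \<sigma>_def)
  have \<sigma>_le: "\<sigma> \<le> real n"
    using \<sigma> mult_left_mono[OF \<sigma>(2), of \<sigma>] by (simp add: power2_eq_square)
  have q: "0 \<le> q" "q \<le> 1" using n by (auto simp: q_def divide_le_eq_1 intro!: power_le_one)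
  define \<mu> where "\<mu> = real n * q"
  define D where "D = \<bar>a - (real n)\<^sup>2 * (1 - q\<^sup>2) / 4\<bar>"
  \<comment> \<open>The slope at \<open>m = \<mu>\<close> of the phase
    \<open>- s * m\<^sup>2 / 4\<close>.\<close>
  define t' where "t' = - (s * \<mu> / 2)"
  define u where "u m = s\<^sup>2 * (real n * (real n - 1) * (2 * real n + 5) / 6
      - real m * (real m - 1) * (2 * real m + 5) / 6) / 24" for m
  \<comment> \<open>The leading part of \<open>u m\<close> once \<open>m / n\<close> is replaced by
    \<open>q\<close>.\<close>
  define v where "v = t\<^sup>2 * (1 - q ^ 3) / 72"
  define \<theta> where "\<theta> m = (real n * (real n - 1) - real m * (real m - 1)) / 4" for m
  define P where "P m = (\<Prod>l\<in>{m..<n}. uniform_char l s)" for m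
  have sn: "\<bar>s\<bar> * real n = \<bar>t\<bar> / \<sigma>"
    using \<sigma>(1) unfolding s_def \<sigma>_def[symmetric] \<sigma>(3)[symmetric] by (simp add: eval_nat_numeral field_simps)
  have s2: "s\<^sup>2 = t\<^sup>2 / real n ^ 3"
    unfolding s_def \<sigma>_def[symmetric] \<sigma>(3)[symmetric] by (simp add: power_divide flip: power_mult)
  have v: "0 \<le> v" using q by (simp add: v_def power_le_one)

  \<comment> \<open>The linearisation leaves exactly a quarter of the squared deviation; the other
    two terms are the centring error and the lower-order part of
    \<open>n * (n - 1) - m * (m - 1)\<close>.\<close>
  have phase: "\<bar>s * (\<theta> m - a) - t' * (real m - \<mu>)\<bar> \<le> \<bar>s\<bar> / 4 * (real m - \<mu>)\<^sup>2 + (\<bar>s\<bar> * D + \<bar>s\<bar> * real n)"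
    if m: "m \<le> n" for m
  proof -
    have "s * (\<theta> m - a) - t' * (real m - \<mu>) =
        s * (- ((real m - \<mu>)\<^sup>2 / 4) - (a - (real n)\<^sup>2 * (1 - q\<^sup>2) / 4) - (real n - real m) / 4)"
      by (simp add: \<theta>_def t'_def \<mu>_def power2_eq_square field_simps)
    also have "\<bar>\<dots>\<bar> = \<bar>s\<bar> * \<bar>- ((real m - \<mu>)\<^sup>2 / 4) - (a - (real n)\<^sup>2 * (1 - q\<^sup>2) / 4) - (real n - real m) / 4\<bar>"
      by (rule abs_mult)
    also have "\<dots> \<le> \<bar>s\<bar> * ((real m - \<mu>)\<^sup>2 / 4 + D + real n)"
    proof (rule mult_left_mono)
      show "\<bar>- ((real m - \<mu>)\<^sup>2 / 4) - (a - (real n)\<^sup>2 * (1 - q\<^sup>2) / 4) - (real n - real m) / 4\<bar>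
          \<le> (real m - \<mu>)\<^sup>2 / 4 + D + real n"
      proof -
        have "\<bar>- (x / 4) - d - z / 4\<bar> \<le> x / 4 + \<bar>d\<bar> + w" if "0 \<le> x" "0 \<le> z" "z \<le> w" for x d z w :: real
          using that by linarith
        then show ?thesis unfolding D_def using m by simp
      qed
    qed simp
    finally show ?thesis by (simp add: algebra_simps)
  qed
  have damping: "\<bar>u m - v\<bar> \<le> t\<^sup>2 * \<bar>real m / real n - q\<bar> + t\<^sup>2 / \<sigma>" if m: "m \<le> n" for m
  proof -
    let ?d = "(real n * (real n - 1) * (2 * real n + 5) / 6 - real m * (real m - 1) * (2 * real m + 5) / 6) / real n ^ 3
      - (1 - q ^ 3) / 3"
    have "t\<^sup>2 / N * X / 24 - t\<^sup>2 * y / 72 = t\<^sup>2 * ((X / N - y / 3) / 24)" for N X y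
      by (simp add: diff_divide_distrib right_diff_distrib)
    then have "u m - v = t\<^sup>2 * (?d / 24)"
      unfolding u_def v_def s2 by (simp only:)
    then have "\<bar>u m - v\<bar> = t\<^sup>2 * (\<bar>?d\<bar> / 24)"
      by (simp only: abs_mult abs_divide abs_numeral abs_power2)
    also have "\<dots> \<le> t\<^sup>2 * (\<bar>real m / real n - q\<bar> + 1 / \<sigma>)"
    proof (rule mult_left_mono)
      have *: "d / 24 \<le> x + z" if "d \<le> 4 / y + x" "1 / y \<le> z" "0 \<le> x" "0 \<le> z" for d x y z :: real
        using that by linarith
      show "\<bar>?d\<bar> / 24 \<le> \<bar>real m / real n - q\<bar> + 1 / \<sigma>"
      proof (rule *)
        show "\<bar>?d\<bar> \<le> 4 / real n + \<bar>real m / real n - q\<bar>"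
          using abs_cubic_sum_diff_le[OF m _ q] n by simp
        show "1 / real n \<le> 1 / \<sigma>" using \<sigma> \<sigma>_le n by (intro divide_left_mono) auto
      qed (use \<sigma>(1) in auto)
    qed simp
    finally show ?thesis by (simp add: algebra_simps)
  qed
  have u: "0 \<le> u m" if "m \<le> n" for m
    unfolding u_def sum_variance_atLeastLessThan[OF that, symmetric] by (simp add: sum_nonneg)

  have expect: "measure_pmf.expectation (inversions_pmf r n) (\<lambda>I. iexp (s * (real I - a)))
      = expect_untouched n r (\<lambda>m. iexp (- (s * a)) * P m)"
  proof -
    have "iexp (s * (real I - a)) = iexp (- (s * a)) * iexp (s * real I)" for I
      unfolding exp_add[symmetric] by (simp add: algebra_simps)
    then have "measure_pmf.expectation (inversions_pmf r n) (\<lambda>I. iexp (s * (real I - a)))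
      = iexp (- (s * a)) * measure_pmf.expectation (inversions_pmf r n) (\<lambda>I. iexp (s * real I))"
      by (simp only: integral_mult_right_zero)
    then show ?thesis
      using n unfolding P_def by (simp only: expectation_inversions_pmf expect_untouched_cmult)
  qed
  define C where "C = (\<bar>t\<bar> ^ 3 + t ^ 4) / \<sigma> + (\<bar>s\<bar> * D + \<bar>t\<bar> / \<sigma>) + t\<^sup>2 / \<sigma>"
  define H where "H m = iexp (t' * (real m - \<mu>)) * complex_of_real (exp (- v))" for m
  have pointwise: "cmod (iexp (- (s * a)) * P m - H m)
      \<le> (C + \<bar>s\<bar> / 4 * (real m - \<mu>)\<^sup>2) + t\<^sup>2 * \<bar>real m / real n - q\<bar>" if m: "m \<le> n" for m
  proof -
    \<comment> \<open>\<open>G\<close> keeps the exact mean and variance given \<open>m\<close>; it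
      stands between the product \<open>P m\<close> and the linearised \<open>H m\<close>.\<close>
    define G where "G = iexp (s * (\<theta> m - a)) * complex_of_real (exp (- u m))"
    have G: "G = iexp (- (s * a)) * (iexp (s * \<theta> m) * complex_of_real (exp (- u m)))"
      unfolding G_def mult.assoc[symmetric] exp_add[symmetric] by (simp add: algebra_simps)
    have "cmod (iexp (- (s * a)) * P m - G) = cmod (P m - iexp (s * \<theta> m) * complex_of_real (exp (- u m)))"
      unfolding G right_diff_distrib[symmetric] norm_mult norm_exp_i_times by simp
    also have "\<dots> \<le> (\<bar>t\<bar> ^ 3 + t ^ 4) / \<sigma>"
      using cmod_prod_uniform_char_le[OF m, of t] n unfolding P_def \<theta>_def u_def \<sigma>_def s_def by simp
    finally have 1: "cmod (iexp (- (s * a)) * P m - G) \<le> (\<bar>t\<bar> ^ 3 + t ^ 4) / \<sigma>" .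
    have 2: "cmod (G - H m) \<le> \<bar>s * (\<theta> m - a) - t' * (real m - \<mu>)\<bar> + \<bar>u m - v\<bar>"
      unfolding G_def H_def by (rule cmod_polar_diff_le[OF u[OF m] v])
    have "cmod (iexp (- (s * a)) * P m - H m) \<le> cmod (iexp (- (s * a)) * P m - G) + cmod (G - H m)"
      using norm_triangle_ineq[of "iexp (- (s * a)) * P m - G" "G - H m"] by simp
    moreover have "x \<le> (A + (S + T) + Z + F) + Y"
      if "x \<le> p + g" "p \<le> A" "g \<le> f + d" "f \<le> F + (S + T)" "d \<le> Y + Z"
      for x p g f d A S T F Y Z :: real
      using that by linarith
    ultimately show ?thesis
      unfolding C_def using 1 2 phase[OF m, unfolded sn] damping[OF m] by blast
  qed
  \<comment> \<open>On averaging over \<open>m\<close>, the variance bound turns the quadratic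
    remainder into a multiple of \<open>\<bar>s\<bar> * n\<close>, which is
    \<open>\<bar>t\<bar> / \<sigma>\<close>.\<close>
  have "cmod (expect_untouched n r (\<lambda>m. iexp (- (s * a)) * P m) - expect_untouched n r H)
     \<le> expect_untouched n r (\<lambda>m. (C + \<bar>s\<bar> / 4 * (real m - \<mu>)\<^sup>2) + t\<^sup>2 * \<bar>real m / real n - q\<bar>)"
    unfolding expect_untouched_diff[symmetric] by (rule expect_untouched_norm_le[OF pointwise])
  also have "\<dots> = C + \<bar>s\<bar> / 4 * expect_untouched n r (\<lambda>m. (real m - \<mu>)\<^sup>2)
      + t\<^sup>2 * expect_untouched n r (\<lambda>m. \<bar>real m / real n - q\<bar>)"
    by (simp only: expect_untouched_add expect_untouched_cmult expect_untouched_const)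
  also have "\<dots> \<le> C + \<bar>s\<bar> / 4 * real n + t\<^sup>2 * (1 / \<sigma>)"
    using expect_untouched_variance_le[OF n, of r] expect_untouched_abs_deviation_le[OF n, of r]
    unfolding \<mu>_def q_def \<sigma>_def by (intro add_mono mult_left_mono order_refl) auto
  finally have 1: "cmod (expect_untouched n r (\<lambda>m. iexp (- (s * a)) * P m) - expect_untouched n r H)
     \<le> C + \<bar>t\<bar> / \<sigma> / 4 + t\<^sup>2 / \<sigma>" using sn by (simp add: algebra_simps)

  have t'2: "t'\<^sup>2 = t\<^sup>2 * q\<^sup>2 / (4 * real n)"
    using n unfolding t'_def \<mu>_def power2_minus power_divide power_mult_distrib s2
    by (simp add: eval_nat_numeral field_simps)
  have abs_t': "\<bar>t'\<bar> = q / 2 * (\<bar>t\<bar> / \<sigma>)"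
    using sn q unfolding t'_def \<mu>_def by (simp add: abs_mult field_simps)
  \<comment> \<open>Since \<open>\<bar>t'\<bar>\<close> carries a factor \<open>q\<close>, each term
    of the accumulated error contains \<open>q\<^sup>2\<close>. Trading \<open>r * q\<^sup>2\<close>
    for \<open>n\<close> makes the estimate uniform in \<open>r\<close>.\<close>
  have rq: "real r * q\<^sup>2 \<le> \<sigma>\<^sup>2"
  proof -
    have "real r * q * q \<le> real n * 1"
      using mult_power_le[of n r] n q by (intro mult_mono) (auto simp: q_def)
    then show ?thesis unfolding \<sigma>(3) by (simp add: power2_eq_square mult.assoc)
  qed
  have "real r * (\<bar>t'\<bar> ^ 3 + t' ^ 4 + t'\<^sup>2 / \<sigma>)
    = (real r * q\<^sup>2) * (q / 8 * (\<bar>t\<bar> ^ 3 / \<sigma> ^ 3) + q\<^sup>2 / 16 / \<sigma> * (t ^ 4 / \<sigma> ^ 3) + 1 / 4 * (t\<^sup>2 / \<sigma> ^ 3))"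
  proof -
    have "t' ^ 4 = \<bar>t'\<bar> ^ 4" "t'\<^sup>2 = \<bar>t'\<bar>\<^sup>2" by simp_all
    moreover have "t ^ 4 = \<bar>t\<bar> ^ 4" "t\<^sup>2 = \<bar>t\<bar>\<^sup>2" by simp_all
    ultimately show ?thesis
      using \<sigma>(1) unfolding abs_t' by (simp only:) (simp add: eval_nat_numeral field_simps)
  qed
  also have "\<dots> \<le> \<sigma>\<^sup>2 * (1 * (\<bar>t\<bar> ^ 3 / \<sigma> ^ 3) + 1 * (t ^ 4 / \<sigma> ^ 3) + 1 * (t\<^sup>2 / \<sigma> ^ 3))"
  proof (intro mult_mono add_mono rq)
    have "q\<^sup>2 \<le> 1" using q by (simp add: power_le_one)
    then show "q\<^sup>2 / 16 / \<sigma> \<le> 1" using \<sigma> by (simp add: divide_le_eq)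
  qed (use q \<sigma> in auto)
  also have "\<dots> = (\<bar>t\<bar> ^ 3 + t ^ 4 + t\<^sup>2) / \<sigma>"
    using \<sigma>(1) by (simp add: field_simps eval_nat_numeral)
  finally have r: "real r * (\<bar>t'\<bar> ^ 3 + t' ^ 4 + t'\<^sup>2 / \<sigma>) \<le> (\<bar>t\<bar> ^ 3 + t ^ 4 + t\<^sup>2) / \<sigma>" .
  let ?W = "expect_untouched n r (\<lambda>m. iexp (t' * (real m - \<mu>)))"
  have H: "expect_untouched n r H = ?W * complex_of_real (exp (- v))"
    unfolding H_def by (rule expect_untouched_bounded_linear[OF bounded_linear_mult_left])
  have E: "exp (- (t\<^sup>2 * (q\<^sup>2 * untouched_variance n r / (4 * real n) + (1 - q ^ 3) / 36) / 2))
      = exp (- (t'\<^sup>2 * untouched_variance n r / 2)) * exp (- v)"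
    unfolding t'2 exp_add[symmetric] v_def by (simp add: field_simps)
  have "cmod (expect_untouched n r H
      - exp (- (t\<^sup>2 * (q\<^sup>2 * untouched_variance n r / (4 * real n) + (1 - q ^ 3) / 36) / 2)))
    = cmod (?W - exp (- (t'\<^sup>2 * untouched_variance n r / 2))) * exp (- v)"
    unfolding H E of_real_mult left_diff_distrib[symmetric] norm_mult norm_of_real by simp
  also have "\<dots> \<le> (\<bar>t\<bar> ^ 3 + t ^ 4 + t\<^sup>2) / \<sigma> * 1"
  proof (rule mult_mono)
    show "cmod (?W - exp (- (t'\<^sup>2 * untouched_variance n r / 2))) \<le> (\<bar>t\<bar> ^ 3 + t ^ 4 + t\<^sup>2) / \<sigma>"
      using char_untouched_approx[OF n, of r t'] r unfolding \<mu>_def q_def \<sigma>_def by linarith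
  qed (use v \<sigma> in auto)
  finally have 2: "cmod (expect_untouched n r H
      - exp (- (t\<^sup>2 * (q\<^sup>2 * untouched_variance n r / (4 * real n) + (1 - q ^ 3) / 36) / 2)))
    \<le> (\<bar>t\<bar> ^ 3 + t ^ 4 + t\<^sup>2) / \<sigma>" by simp
  have "cmod (expect_untouched n r (\<lambda>m. iexp (- (s * a)) * P m)
      - exp (- (t\<^sup>2 * (q\<^sup>2 * untouched_variance n r / (4 * real n) + (1 - q ^ 3) / 36) / 2)))
    \<le> (C + \<bar>t\<bar> / \<sigma> / 4 + t\<^sup>2 / \<sigma>) + (\<bar>t\<bar> ^ 3 + t ^ 4 + t\<^sup>2) / \<sigma>"
    using norm_triangle_le[OF add_mono[OF 1 2]] by simp
  also have "\<dots> \<le> (2 * \<bar>t\<bar> ^ 3 + 2 * t ^ 4 + 2 * \<bar>t\<bar> + 3 * t\<^sup>2) / \<sigma> + \<bar>s\<bar> * D"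
    using \<sigma>(1) unfolding C_def add_divide_distrib by (simp add: field_simps)
  also have "\<bar>s\<bar> * D = \<bar>t\<bar> * \<bar>(a - (real n)\<^sup>2 * (1 - q\<^sup>2) / 4) / sqrt (real n) ^ 3\<bar>"
    unfolding s_def D_def abs_divide by simp
  finally show ?thesis unfolding expect \<sigma>_def .
qed

section \<open>Convergence in distribution\<close>

lemma prob_space_std_normal: "prob_space std_normal_distribution"
  by (rule prob_space_normal_density) simp

lemma normal_distribution_zero_conv_distr:
  assumes "v > 0"
  shows "normal_distribution 0 v = distr std_normal_distribution lborel (\<lambda>x. sqrt v * x)"
proof -
  interpret prob_space std_normal_distribution by (rule prob_space_std_normal)
  have "distributed std_normal_distribution lborel (\<lambda>x. x) (normal_density 0 1)"
    by (auto simp: distributed_def distr_id2)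
  from normal_density_affine[OF this, of "sqrt v" 0] assms
  have "distributed std_normal_distribution lborel (\<lambda>x. sqrt v * x) (normal_density 0 (sqrt v))"
    by simp
  from distributed_distr_eq_density[OF this] show ?thesis
    by (simp add: normal_distribution_def)
qed

lemma real_distribution_normal_distribution:
  assumes "v > 0"
  shows "real_distribution (normal_distribution 0 v)"
  using prob_space_normal_density[of "sqrt v" 0] assms
  by (auto simp: normal_distribution_def real_distribution_def real_distribution_axioms_def)

lemma char_normal_distribution_zero:
  assumes "v > 0"
  shows "char (normal_distribution 0 v) t = exp (- (t\<^sup>2 * v / 2))"
proof -
  have "char (normal_distribution 0 v) t = char std_normal_distribution (t * sqrt v)"
    unfolding char_def normal_distribution_zero_conv_distr[OF assms]
    by (subst integral_distr) (auto simp: mult.assoc)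
  then show ?thesis using assms by (simp add: char_std_normal_distribution power_mult_distrib)
qed

text \<open>The mean involves \<open>n\<^sup>2 * q\<^sup>2\<close> and is divided by
  \<open>n\<close> to the power 3/2, so \<open>q\<close> has to converge faster than
  \<open>1 / sqrt n\<close>. The rounded exponent lies between \<open>c * n - 1\<close> and
  \<open>c * n\<close>; a base below 1 reverses the order.\<close>

lemma sqrt_mult_power_minus_exp_tendsto_0:
  fixes c :: real
  assumes c: "c > 0"
  shows "(\<lambda>n. sqrt (real n) * ((1 - 1 / real n) ^ nat \<lfloor>c * real n\<rfloor> - exp (- c))) \<longlonglongrightarrow> 0"
proof (rule tendsto_sandwich)
  have *: "(1 - 1 / real n) powr (c * real n) \<le> (1 - 1 / real n) ^ nat \<lfloor>c * real n\<rfloor> \<and>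
      (1 - 1 / real n) ^ nat \<lfloor>c * real n\<rfloor> \<le> (1 - 1 / real n) powr (c * real n - 1)" if n: "n \<ge> 2" for n
  proof -
    have b: "0 < 1 - 1 / real n" "1 - 1 / real n \<le> 1" using n by auto
    have "0 \<le> \<lfloor>c * real n\<rfloor>" using c by simp
    then have r: "real (nat \<lfloor>c * real n\<rfloor>) \<le> c * real n" "c * real n - 1 \<le> real (nat \<lfloor>c * real n\<rfloor>)"
      by linarith+
    have "(1 - 1 / real n) ^ nat \<lfloor>c * real n\<rfloor> = (1 - 1 / real n) powr real (nat \<lfloor>c * real n\<rfloor>)"
      using b by (simp add: powr_realpow)
    then show ?thesis using powr_mono'[OF r(1)] powr_mono'[OF r(2)] b by simp
  qed
  show "\<forall>\<^sub>F n in sequentially. sqrt (real n) * ((1 - 1 / real n) powr (c * real n) - exp (- c))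
      \<le> sqrt (real n) * ((1 - 1 / real n) ^ nat \<lfloor>c * real n\<rfloor> - exp (- c))"
    using eventually_ge_at_top[of 2] by eventually_elim (use * in \<open>auto intro!: mult_left_mono\<close>)
  show "\<forall>\<^sub>F n in sequentially. sqrt (real n) * ((1 - 1 / real n) ^ nat \<lfloor>c * real n\<rfloor> - exp (- c))
      \<le> sqrt (real n) * ((1 - 1 / real n) powr (c * real n - 1) - exp (- c))"
    using eventually_ge_at_top[of 2] by eventually_elim (use * in \<open>auto intro!: mult_left_mono\<close>)
  show "(\<lambda>n. sqrt (real n) * ((1 - 1 / real n) powr (c * real n) - exp (- c))) \<longlonglongrightarrow> 0"
    using c by real_asymp
  show "(\<lambda>n. sqrt (real n) * ((1 - 1 / real n) powr (c * real n - 1) - exp (- c))) \<longlonglongrightarrow> 0"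
    using c by real_asymp
qed

text \<open>Levy's continuity theorem and the bound of \<open>char_inversions_approx\<close> reduce
  both regimes to two deterministic limits: the centring error is negligible against
  \<open>n\<close> to the power 3/2, and the approximating variances converge.\<close>

lemma weak_conv_inversions:
  fixes r :: "nat \<Rightarrow> nat" and a :: "nat \<Rightarrow> real"
  defines "q \<equiv> \<lambda>n. (1 - 1 / real n) ^ r n"
  assumes v: "v > 0"
    and mean: "(\<lambda>n. (a n - (real n)\<^sup>2 * (1 - (q n)\<^sup>2) / 4) / sqrt (real n) ^ 3) \<longlonglongrightarrow> 0"
    and variance: "(\<lambda>n. (q n)\<^sup>2 * untouched_variance n (r n) / (4 * real n) + (1 - q n ^ 3) / 36) \<longlonglongrightarrow> v"
  shows "weak_conv_m
    (\<lambda>n. distr (measure_pmf (inversions_pmf (r n) n)) borel (\<lambda>I. (real I - a n) / real n powr (3 / 2)))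
    (normal_distribution 0 v)"
proof (rule levy_continuity)
  show "real_distribution (distr (measure_pmf (inversions_pmf (r n) n)) borel
      (\<lambda>I. (real I - a n) / real n powr (3 / 2)))" for n
    by (rule prob_space.real_distribution_distr[OF prob_space_measure_pmf]) simp
  show "real_distribution (normal_distribution 0 v)"
    by (rule real_distribution_normal_distribution[OF v])
  fix t :: real
  define w where "w n = (q n)\<^sup>2 * untouched_variance n (r n) / (4 * real n) + (1 - q n ^ 3) / 36" for n
  define b where "b n = (2 * \<bar>t\<bar> ^ 3 + 2 * t ^ 4 + 2 * \<bar>t\<bar> + 3 * t\<^sup>2) / sqrt (real n)
      + \<bar>t\<bar> * \<bar>(a n - (real n)\<^sup>2 * (1 - (q n)\<^sup>2) / 4) / sqrt (real n) ^ 3\<bar>" for n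
  let ?M = "\<lambda>n. distr (measure_pmf (inversions_pmf (r n) n)) borel (\<lambda>I. (real I - a n) / real n powr (3 / 2))"
  have bound: "norm (char (?M n) t - complex_of_real (exp (- (t\<^sup>2 * w n / 2)))) \<le> b n" if n: "n \<ge> 2" for n
  proof -
    have "real n powr (3 / 2) = (real n powr (1 / 2)) powr 3" unfolding powr_powr by simp
    then have "real n powr (3 / 2) = sqrt (real n) ^ 3"
      using n by (simp add: powr_half_sqrt powr_numeral)
    then have "char (?M n) t = measure_pmf.expectation (inversions_pmf (r n) n)
        (\<lambda>I. iexp (t / sqrt (real n) ^ 3 * (real I - a n)))"
      unfolding char_def by (subst integral_distr) simp_all
    then show ?thesis
      using char_inversions_approx[OF n, of "r n" t "a n"] unfolding w_def b_def q_def by simp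
  qed
  have "(\<lambda>n. (2 * \<bar>t\<bar> ^ 3 + 2 * t ^ 4 + 2 * \<bar>t\<bar> + 3 * t\<^sup>2) * (1 / sqrt (real n))) \<longlonglongrightarrow>
      (2 * \<bar>t\<bar> ^ 3 + 2 * t ^ 4 + 2 * \<bar>t\<bar> + 3 * t\<^sup>2) * 0"
    by (intro tendsto_mult tendsto_const) real_asymp
  then have "b \<longlonglongrightarrow> 0"
    unfolding b_def using tendsto_add[OF _ tendsto_mult_right_zero[OF tendsto_rabs_zero[OF mean]]] by fastforce
  then have "(\<lambda>n. char (?M n) t - complex_of_real (exp (- (t\<^sup>2 * w n / 2)))) \<longlonglongrightarrow> 0"
    by (rule Lim_null_comparison[rotated]) (use bound in \<open>auto intro!: eventually_sequentiallyI[of 2]\<close>)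
  moreover have "(\<lambda>n. complex_of_real (exp (- (t\<^sup>2 * w n / 2)))) \<longlonglongrightarrow> complex_of_real (exp (- (t\<^sup>2 * v / 2)))"
    using variance unfolding w_def by (intro tendsto_intros) auto
  ultimately have "(\<lambda>n. (char (?M n) t - complex_of_real (exp (- (t\<^sup>2 * w n / 2)))) + complex_of_real (exp (- (t\<^sup>2 * w n / 2))))
      \<longlonglongrightarrow> 0 + complex_of_real (exp (- (t\<^sup>2 * v / 2)))"
    by (rule tendsto_add)
  then show "(\<lambda>n. char (?M n) t) \<longlonglongrightarrow> char (normal_distribution 0 v) t"
    by (simp add: char_normal_distribution_zero[OF v])
qed

lemma limit_variance_pos:
  fixes c :: real
  assumes "c > 0"
  shows "(1 + 8 * exp (- 3 * c) - 9 * (1 + c) * exp (- 4 * c)) / 36 > 0"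
proof -
  have "exp (- 3 * c) = exp (- 4 * c) * exp c" by (simp flip: exp_add)
  \<comment> \<open>With this bound the numerator is at least
    \<open>1 - exp (- 3 * c)\<close>.\<close>
  moreover have "(1 + c) * exp (- 4 * c) \<le> exp c * exp (- 4 * c)"
    by (intro mult_right_mono exp_ge_add_one_self) simp
  moreover have "exp (- 3 * c) < 1" using assms by simp
  ultimately show ?thesis by (simp add: algebra_simps)
qed

text \<open>With \<open>q\<close> tending to \<open>e = exp (- c)\<close>, \<open>r / n\<close> to
  \<open>c\<close> and \<open>1 - 1 / n\<close> to 1, the two summands of the variance tend to
  \<open>e\<^sup>2 * (e - e\<^sup>2 - c * e\<^sup>2) / 4\<close> and
  \<open>(1 - e ^ 3) / 36\<close>.\<close>

lemma limit_linear_shuffles: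
  fixes c :: real
  assumes c: "c > 0"
  shows "weak_conv_m
    (\<lambda>n. distr (measure_pmf (inversions_pmf (nat \<lfloor>c * real n\<rfloor>) n)) borel
           (\<lambda>I. (real I - (real n)\<^sup>2 * (1 - exp (- 2 * c)) / 4) / real n powr (3 / 2)))
    (normal_distribution 0 ((1 + 8 * exp (- 3 * c) - 9 * (1 + c) * exp (- 4 * c)) / 36))"
proof (rule weak_conv_inversions[OF limit_variance_pos[OF c]])
  define r where "r n = nat \<lfloor>c * real n\<rfloor>" for n
  define q where "q n = (1 - 1 / real n) ^ r n" for n
  define e where "e = exp (- c)"
  have lim: "(\<lambda>n. sqrt (real n) * (q n - e)) \<longlonglongrightarrow> 0"
    unfolding q_def r_def e_def by (rule sqrt_mult_power_minus_exp_tendsto_0[OF c])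
  have inv_sqrt: "(\<lambda>n. 1 / sqrt (real n)) \<longlonglongrightarrow> 0" by real_asymp
  have "(\<lambda>n. (sqrt (real n) * (q n - e)) * (1 / sqrt (real n)) + e) \<longlonglongrightarrow> 0 * 0 + e"
    by (intro tendsto_add tendsto_mult tendsto_const lim inv_sqrt)
  then have q: "q \<longlonglongrightarrow> e"
  proof (rule Lim_transform_eventually[THEN tendsto_eq_rhs])
    show "\<forall>\<^sub>F n in sequentially. sqrt (real n) * (q n - e) * (1 / sqrt (real n)) + e = q n"
      by (rule eventually_sequentiallyI[of 1]) simp
  qed simp
  \<comment> \<open>This is the normalised centring error, with
    \<open>(q n)\<^sup>2 - e\<^sup>2\<close> factored.\<close>
  have "(\<lambda>n. sqrt (real n) * (q n - e) * ((q n + e) / 4)) \<longlonglongrightarrow> 0 * ((e + e) / 4)"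
    by (intro tendsto_intros lim q) simp
  then show "(\<lambda>n. ((real n)\<^sup>2 * (1 - exp (- 2 * c)) / 4 -
      (real n)\<^sup>2 * (1 - ((1 - 1 / real n) ^ nat \<lfloor>c * real n\<rfloor>)\<^sup>2) / 4) / sqrt (real n) ^ 3) \<longlonglongrightarrow> 0"
    unfolding q_def[unfolded r_def, symmetric]
  proof (rule Lim_transform_eventually[THEN tendsto_eq_rhs])
    have "sqrt (real n) * (q n - e) * ((q n + e) / 4) =
        ((real n)\<^sup>2 * (1 - exp (- 2 * c)) / 4 - (real n)\<^sup>2 * (1 - (q n)\<^sup>2) / 4) / sqrt (real n) ^ 3" if "n \<ge> 1" for n
    proof -
      define \<sigma> where "\<sigma> = sqrt (real n)"
      have \<sigma>: "\<sigma> > 0" "real n = \<sigma>\<^sup>2" using that by (auto simp: \<sigma>_def)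
      have "exp (- 2 * c) = e\<^sup>2" by (simp add: e_def flip: exp_double)
      then show ?thesis unfolding \<sigma>_def[symmetric] using \<sigma>
        by (simp add: field_simps eval_nat_numeral)
    qed
    then show "\<forall>\<^sub>F n in sequentially. sqrt (real n) * (q n - e) * ((q n + e) / 4) =
        ((real n)\<^sup>2 * (1 - exp (- 2 * c)) / 4 - (real n)\<^sup>2 * (1 - (q n)\<^sup>2) / 4) / sqrt (real n) ^ 3"
      by (auto intro!: eventually_sequentiallyI[of 1])
  qed simp
  have \<rho>: "(\<lambda>n. 1 - 1 / real n) \<longlonglongrightarrow> 1" by real_asymp
  have rn: "(\<lambda>n. real (r n) / real n) \<longlonglongrightarrow> c" unfolding r_def using c by real_asymp
  have "(\<lambda>n. (q n)\<^sup>2 / 4 * (1 / (1 - 1 / real n) * (q n - (q n)\<^sup>2) - real (r n) / real n / (1 - 1 / real n)\<^sup>2 * (q n)\<^sup>2) + (1 - q n ^ 3) / 36)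
     \<longlonglongrightarrow> e\<^sup>2 / 4 * (1 / 1 * (e - e\<^sup>2) - c / 1\<^sup>2 * e\<^sup>2) + (1 - e ^ 3) / 36"
    by (intro tendsto_intros \<rho> rn q) simp_all
  moreover have "e\<^sup>2 / 4 * (1 / 1 * (e - e\<^sup>2) - c / 1\<^sup>2 * e\<^sup>2) + (1 - e ^ 3) / 36 =
      (1 + 8 * exp (- 3 * c) - 9 * (1 + c) * exp (- 4 * c)) / 36"
  proof -
    have "exp (- 3 * c) = e ^ 3" "exp (- 4 * c) = e ^ 4" by (simp_all add: e_def flip: exp_of_nat_mult)
    then show ?thesis by (simp add: field_simps eval_nat_numeral)
  qed
  moreover have "\<forall>\<^sub>F n in sequentially. (q n)\<^sup>2 / 4 * (1 / (1 - 1 / real n) * (q n - (q n)\<^sup>2)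
        - real (r n) / real n / (1 - 1 / real n)\<^sup>2 * (q n)\<^sup>2) + (1 - q n ^ 3) / 36 =
      (q n)\<^sup>2 * untouched_variance n (r n) / (4 * real n) + (1 - q n ^ 3) / 36"
    by (rule eventually_sequentiallyI[of 1])
      (simp add: untouched_variance_def Let_def q_def[symmetric] diff_divide_distrib right_diff_distrib)
  ultimately have "(\<lambda>n. (q n)\<^sup>2 * untouched_variance n (r n) / (4 * real n) + (1 - q n ^ 3) / 36)
      \<longlonglongrightarrow> (1 + 8 * exp (- 3 * c) - 9 * (1 + c) * exp (- 4 * c)) / 36"
    by (simp only: Lim_transform_eventually)
  then show "(\<lambda>n. ((1 - 1 / real n) ^ nat \<lfloor>c * real n\<rfloor>)\<^sup>2 * untouched_variance n (nat \<lfloor>c * real n\<rfloor>) / (4 * real n) +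
      (1 - ((1 - 1 / real n) ^ nat \<lfloor>c * real n\<rfloor>) ^ 3) / 36)
    \<longlonglongrightarrow> (1 + 8 * exp (- 3 * c) - 9 * (1 + c) * exp (- 4 * c)) / 36"
    unfolding q_def r_def .
qed

text \<open>From \<open>1 - x \<le> exp (- x)\<close> follows
  \<open>sqrt n * q\<^sup>2 \<le> exp (- 2 * c n)\<close>, so beyond the threshold the term
  \<open>n\<^sup>2 * q\<^sup>2 / 4\<close> of the mean is negligible against \<open>n\<close> to the
  power 3/2. In the variance the contribution of \<open>m\<close> carries a factor
  \<open>q\<^sup>2\<close> and vanishes, leaving the value for a uniformly random
  permutation.\<close>

lemma limit_long_shuffles:
  fixes r :: "nat \<Rightarrow> nat" and c :: "nat \<Rightarrow> real"
  assumes c: "filterlim c at_top sequentially"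
    and r: "\<forall>\<^sub>F n in sequentially. real (r n) \<ge> real n * ln (real n) / 4 + c n * real n"
  shows "weak_conv_m
    (\<lambda>n. distr (measure_pmf (inversions_pmf (r n) n)) borel
           (\<lambda>I. (real I - (real n)\<^sup>2 / 4) / real n powr (3 / 2)))
    (normal_distribution 0 (1 / 36))"
proof (rule weak_conv_inversions)
  define q where "q n = (1 - 1 / real n) ^ r n" for n
  have q: "0 \<le> q n" "q n \<le> 1" if "n \<ge> 1" for n
    using that by (auto simp: q_def divide_le_eq_1 intro!: power_le_one)
  have q_le: "sqrt (real n) * (q n)\<^sup>2 \<le> exp (- 2 * c n)"
    if n: "n \<ge> 1" and r: "real (r n) \<ge> real n * ln (real n) / 4 + c n * real n" for n
  proof -
    have "q n \<le> exp (- (1 / real n)) ^ r n"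
      unfolding q_def using n exp_ge_add_one_self[of "- (1 / real n)"]
      by (intro power_mono) (auto simp: divide_le_eq_1)
    then have "(q n)\<^sup>2 \<le> (exp (- (1 / real n)) ^ r n)\<^sup>2" using q[OF n] by (intro power_mono) auto
    also have "\<dots> = exp (- (2 * (real (r n) / real n)))"
      by (simp flip: exp_of_nat_mult exp_double)
    also have "\<dots> \<le> exp (- (ln (real n) / 2) - 2 * c n)"
    proof -
      have "ln (real n) / 4 + c n \<le> real (r n) / real n" using r n by (simp add: field_simps)
      then show ?thesis by simp
    qed
    finally have "sqrt (real n) * (q n)\<^sup>2 \<le> sqrt (real n) * exp (- (ln (real n) / 2) - 2 * c n)"
      by (intro mult_left_mono) auto
    \<comment> \<open>The part \<open>n * ln n / 4\<close> of the lower bound for \<open>r n\<close>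
      is spent on cancelling \<open>sqrt n\<close>.\<close>
    also have "\<dots> = exp (- 2 * c n)"
    proof -
      have "sqrt (real n) = exp (ln (real n) / 2)"
        using n by (simp add: powr_half_sqrt[symmetric] powr_def)
      then show ?thesis by (simp flip: exp_add)
    qed
    finally show ?thesis .
  qed
  have exp0: "(\<lambda>n. exp (- 2 * c n)) \<longlonglongrightarrow> 0"
    by (rule filterlim_compose[OF exp_at_bot])
      (use filterlim_tendsto_pos_mult_at_top[OF tendsto_const _ c, of 2] in \<open>simp add: filterlim_uminus_at_top\<close>)
  have sq: "(\<lambda>n. sqrt (real n) * (q n)\<^sup>2) \<longlonglongrightarrow> 0"
  proof (rule tendsto_sandwich[OF _ _ tendsto_const exp0])
    show "\<forall>\<^sub>F n in sequentially. sqrt (real n) * (q n)\<^sup>2 \<le> exp (- 2 * c n)"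
      using r eventually_ge_at_top[of 1] by eventually_elim (rule q_le)
  qed simp
  \<comment> \<open>As \<open>sqrt n\<close> is at least 1 it may be dropped.\<close>
  have q2: "(\<lambda>n. (q n)\<^sup>2) \<longlonglongrightarrow> 0"
    by (rule tendsto_sandwich[OF _ _ tendsto_const sq])
      (use mult_right_mono[of 1 "sqrt (real n)" "(q n)\<^sup>2" for n] in \<open>auto intro!: eventually_sequentiallyI[of 1]\<close>)
  have q0: "q \<longlonglongrightarrow> 0"
    using tendsto_real_sqrt[OF q2] by (simp add: tendsto_rabs_zero_iff)
  have "(\<lambda>n. sqrt (real n) * (q n)\<^sup>2 * (1 / 4)) \<longlonglongrightarrow> 0 * (1 / 4)"
    by (intro tendsto_mult sq tendsto_const)
  then show "(\<lambda>n. ((real n)\<^sup>2 / 4 - (real n)\<^sup>2 * (1 - ((1 - 1 / real n) ^ r n)\<^sup>2) / 4) / sqrt (real n) ^ 3) \<longlonglongrightarrow> 0"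
    unfolding q_def[symmetric]
  proof (rule Lim_transform_eventually[THEN tendsto_eq_rhs])
    have "sqrt (real n) * (q n)\<^sup>2 * (1 / 4) =
        ((real n)\<^sup>2 / 4 - (real n)\<^sup>2 * (1 - (q n)\<^sup>2) / 4) / sqrt (real n) ^ 3" if "n \<ge> 1" for n
    proof -
      define \<sigma> where "\<sigma> = sqrt (real n)"
      have \<sigma>: "\<sigma> > 0" "real n = \<sigma>\<^sup>2" using that by (auto simp: \<sigma>_def)
      show ?thesis unfolding \<sigma>_def[symmetric] using \<sigma>
        by (simp add: field_simps eval_nat_numeral)
    qed
    then show "\<forall>\<^sub>F n in sequentially. sqrt (real n) * (q n)\<^sup>2 * (1 / 4) =
        ((real n)\<^sup>2 / 4 - (real n)\<^sup>2 * (1 - (q n)\<^sup>2) / 4) / sqrt (real n) ^ 3"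
      by (auto intro!: eventually_sequentiallyI[of 1])
  qed simp
  \<comment> \<open>A crude bound uniform in \<open>r n\<close>: \<rho> is at least 1/2, and
    \<open>mult_power_le\<close> controls \<open>r n * q n\<close>.\<close>
  have V: "\<bar>untouched_variance n (r n) / (4 * real n)\<bar> \<le> 2" if n: "n \<ge> 2" for n
  proof -
    define \<rho> where "\<rho> = 1 - 1 / real n"
    have q_\<rho>: "q n = \<rho> ^ r n" by (simp add: q_def \<rho>_def)
    have \<rho>: "\<rho> \<ge> 1 / 2" using n by (simp add: \<rho>_def field_simps)
    have q: "0 \<le> q n" "q n \<le> 1" using q[of n] n by auto
    have rq: "real (r n) / real n * q n \<le> 1"
      using mult_power_le[of n "r n"] n by (simp add: q_def divide_le_eq)
    define A where "A = 1 / \<rho> * (q n - (q n)\<^sup>2)"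
    define B where "B = 1 / \<rho>\<^sup>2 * (real (r n) / real n * q n * q n)"
    have eq: "untouched_variance n (r n) / (4 * real n) = (A - B) / 4"
      using n unfolding A_def B_def
      by (simp add: untouched_variance_def Let_def \<rho>_def[symmetric] q_\<rho>[symmetric] diff_divide_distrib
          right_diff_distrib power2_eq_square)
    have "0 \<le> A" "A \<le> 2 * 1"
    proof -
      have "(q n)\<^sup>2 \<le> q n" using q by (simp add: power2_eq_square mult_left_le)
      then show "0 \<le> A" using \<rho> by (auto simp: A_def)
      show "A \<le> 2 * 1" unfolding A_def
      proof (intro mult_mono)
        show "1 / \<rho> \<le> 2" using \<rho> by (simp add: divide_le_eq)
        show "q n - (q n)\<^sup>2 \<le> 1" using q zero_le_power2[of "q n"] by linarith
      qed (use \<open>(q n)\<^sup>2 \<le> q n\<close> in auto)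
    qed
    moreover have "0 \<le> B" "B \<le> 4 * (1 * 1)"
    proof -
      show "0 \<le> B" using q by (simp add: B_def)
      have "(1 / 2)\<^sup>2 \<le> \<rho>\<^sup>2" using \<rho> by (intro power_mono) auto
      then have "1 / \<rho>\<^sup>2 \<le> 4" using \<rho> by (simp add: divide_le_eq power2_eq_square)
      then show "B \<le> 4 * (1 * 1)" unfolding B_def using q rq by (intro mult_mono) auto
    qed
    ultimately show ?thesis unfolding eq by simp
  qed
  have "(\<lambda>n. (q n)\<^sup>2 * (untouched_variance n (r n) / (4 * real n))) \<longlonglongrightarrow> 0"
  proof (rule Lim_null_comparison)
    show "\<forall>\<^sub>F n in sequentially. norm ((q n)\<^sup>2 * (untouched_variance n (r n) / (4 * real n))) \<le> (q n)\<^sup>2 * 2"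
      by (rule eventually_sequentiallyI[of 2])
        (simp only: real_norm_def abs_mult abs_power2 mult_left_mono V zero_le_power2)
    show "(\<lambda>n. (q n)\<^sup>2 * 2) \<longlonglongrightarrow> 0" using tendsto_mult_left_zero[OF q2] .
  qed
  moreover have "(\<lambda>n. (1 - q n ^ 3) / 36) \<longlonglongrightarrow> (1 - 0 ^ 3) / 36"
    by (intro tendsto_intros q0) simp
  ultimately have "(\<lambda>n. (q n)\<^sup>2 * (untouched_variance n (r n) / (4 * real n)) + (1 - q n ^ 3) / 36) \<longlonglongrightarrow> 0 + (1 - 0 ^ 3) / 36"
    by (rule tendsto_add)
  then show "(\<lambda>n. ((1 - 1 / real n) ^ r n)\<^sup>2 * untouched_variance n (r n) / (4 * real n) +
      (1 - ((1 - 1 / real n) ^ r n) ^ 3) / 36) \<longlonglongrightarrow> 1 / 36"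
    unfolding q_def[symmetric] by simp
qed simp

theorem theorem1p3:
  shows "(\<forall>c::real. c > 0 \<longrightarrow>
      weak_conv_m
        (\<lambda>n. distr (measure_pmf (inversions_pmf (nat \<lfloor>c * real n\<rfloor>) n)) borel
               (\<lambda>I. (real I - (real n)\<^sup>2 * (1 - exp (- 2 * c)) / 4) / real n powr (3 / 2)))
        (normal_distribution 0
           ((1 + 8 * exp (- 3 * c) - 9 * (1 + c) * exp (- 4 * c)) / 36)))
    \<and>
    (\<forall>r :: nat \<Rightarrow> nat.
      (\<forall>n\<ge>1. r n > 0) \<longrightarrow>
      (\<exists>c :: nat \<Rightarrow> real. filterlim c at_top sequentially \<and>
         (\<forall>\<^sub>F n in sequentially. real (r n) \<ge> real n * ln (real n) / 4 + c n * real n)) \<longrightarrow>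
      weak_conv_m
        (\<lambda>n. distr (measure_pmf (inversions_pmf (r n) n)) borel
               (\<lambda>I. (real I - (real n)\<^sup>2 / 4) / real n powr (3 / 2)))
        (normal_distribution 0 (1 / 36)))"
proof (intro conjI allI impI)
  fix c :: real
  assume "c > 0"
  then show "weak_conv_m
        (\<lambda>n. distr (measure_pmf (inversions_pmf (nat \<lfloor>c * real n\<rfloor>) n)) borel
               (\<lambda>I. (real I - (real n)\<^sup>2 * (1 - exp (- 2 * c)) / 4) / real n powr (3 / 2)))
        (normal_distribution 0
           ((1 + 8 * exp (- 3 * c) - 9 * (1 + c) * exp (- 4 * c)) / 36))"
    by (rule limit_linear_shuffles)
next
  fix r :: "nat \<Rightarrow> nat"
  assume "\<exists>c :: nat \<Rightarrow> real. filterlim c at_top sequentially \<and>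
         (\<forall>\<^sub>F n in sequentially. real (r n) \<ge> real n * ln (real n) / 4 + c n * real n)"
  then show "weak_conv_m
        (\<lambda>n. distr (measure_pmf (inversions_pmf (r n) n)) borel
               (\<lambda>I. (real I - (real n)\<^sup>2 / 4) / real n powr (3 / 2)))
        (normal_distribution 0 (1 / 36))"
    using limit_long_shuffles by blast
qed

end
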